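(* Let $G$ be a compact abelian group with countable dual group $\widehat{G}$ and Haar probability measure $\mathbf{m}$, let $\Omega=\mathrm{Epi}(G)^{\mathbb{N}}$ with shift $\sigma$, let $\mu$ be a $\sigma$-invariant probability measure on $\Omega$, and let $S(\omega,x)=(\sigma\omega,\omega_0x)$ on $\Omega\times G$. Suppose that this skew product of epimorphisms is Fourier tight. Then $\mu\otimes\mathbf{m}$ is $S$-ergodic if and only if $\mu$ is $\sigma$-ergodic.
   Context: $\mathrm{Epi}(G)$ is the semigroup of continuous surjective endomorphisms of $G$; every such map preserves $\mathbf{m}$. Elements of $\Omega=\mathrm{Epi}(G)^{\mathbb{N}}$ are sequences $\omega=(\omega_n)_{n\ge 0}$, and $\sigma((\omega_n)_{n\ge0})=(\omega_{n+1})_{n\ge0}$. $\Omega$ carries a $\sigma$-algebra for which $\sigma$ is measurable and the map $(\omega,x)\mapsto \omega_0x$ from $\Omega\times G$ to $G$ (with $G$ carrying its Borel $\sigma$-algebra) is measurable. The skew product transformation is $S:\Omega\times G\to\Omega\times G$, $S(\omega,x)=(\sigma\omega,\omega_0x)$; it preserves $\mu\otimes\mathbf{m}$. For an endomorphism $\tau$ of $G$, its adjoint $\tau^*:\widehat G\to\widehat G$ is $\tau^*(\gamma)=\gamma\circ\tau$; $1$ denotes the trivial character. The skew product is called Fourier tight if for $\mu$-almost every $\omega$, for any finite set $\Gamma\subset\widehat{G}$ there is an integer $m_0=m_0(\omega,\Gamma)$ such that for all $m\ge m_0$, $(\omega_{m-1}\omega_{m-2}\cdots\omega_1\omega_0)^*(\widehat{G}\setminus\{1\})\subset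 \widehat G\setminus\Gamma$. A probability measure $\nu$ is called $T$-ergodic if it is $T$-invariant and ergodic for $T$. *)

theory Defs
  imports "HOL-Probability.Probability"
begin

(* The group is a type of class topological_ab_group_add, so it is written additively;
   characters take values in the unit circle of the complex numbers. *)

definition dual_group :: "('a :: topological_ab_group_add \<Rightarrow> complex) set"
  where "dual_group =
    {\<gamma>. continuous_on UNIV \<gamma> \<and> (\<forall>x y. \<gamma> (x + y) = \<gamma> x * \<gamma> y) \<and> (\<forall>x. norm (\<gamma> x) = 1)}"

definition trivial_char :: "'a \<Rightarrow> complex"
  where "trivial_char = (\<lambda>x. 1)"

(* A translation-invariant Radon probability measure on the Borel sets.  For finite measures
   on a compact Hausdorff space, inner regularity by compact sets also gives outer regularity. *)
definition haar_prob :: "('a :: {topological_ab_group_add, t2_space}) measure \<Rightarrow> bool"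
  where "haar_prob m \<longleftrightarrow>
    prob_space m \<and> sets m = sets borel \<and>
    (\<forall>a. distr m m (\<lambda>x. a + x) = m) \<and>
    (\<forall>B\<in>sets m. emeasure m B = (SUP K\<in>{K. K \<subseteq> B \<and> compact K}. emeasure m K))"

definition Epi :: "('a :: topological_ab_group_add \<Rightarrow> 'a) set"
  where "Epi = {\<tau>. continuous_on UNIV \<tau> \<and> (\<forall>x y. \<tau> (x + y) = \<tau> x + \<tau> y) \<and> surj \<tau>}"

definition Epi_seqs :: "(nat \<Rightarrow> 'a :: topological_ab_group_add \<Rightarrow> 'a) set"
  where "Epi_seqs = {\<omega>. \<forall>n. \<omega> n \<in> Epi}"

definition seq_shift :: "(nat \<Rightarrow> 'b) \<Rightarrow> (nat \<Rightarrow> 'b)"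
  where "seq_shift \<omega> = (\<lambda>n. \<omega> (Suc n))"

definition skew_product ::
    "(nat \<Rightarrow> 'a \<Rightarrow> 'a) \<times> 'a \<Rightarrow> (nat \<Rightarrow> 'a \<Rightarrow> 'a) \<times> 'a"
  where "skew_product = (\<lambda>(\<omega>, x). (seq_shift \<omega>, \<omega> 0 x))"

definition adjoint_char :: "('a \<Rightarrow> 'a) \<Rightarrow> ('a \<Rightarrow> complex) \<Rightarrow> ('a \<Rightarrow> complex)"
  where "adjoint_char \<tau> \<gamma> = \<gamma> \<circ> \<tau>"

(* cocycle m \<omega> = \<omega> (m - 1) \<circ> ... \<circ> \<omega> 1 \<circ> \<omega> 0 *)
primrec cocycle :: "nat \<Rightarrow> (nat \<Rightarrow> 'a \<Rightarrow> 'a) \<Rightarrow> ('a \<Rightarrow> 'a)"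
  where
    "cocycle 0 \<omega> = id"
  | "cocycle (Suc m) \<omega> = \<omega> m \<circ> cocycle m \<omega>"

definition fourier_tight ::
    "(nat \<Rightarrow> 'a :: topological_ab_group_add \<Rightarrow> 'a) measure \<Rightarrow> bool"
  where "fourier_tight \<mu> \<longleftrightarrow>
    (AE \<omega> in \<mu>. \<forall>\<Gamma>. finite \<Gamma> \<and> \<Gamma> \<subseteq> dual_group \<longrightarrow>
      (\<exists>m\<^sub>0. \<forall>m\<ge>m\<^sub>0.
        adjoint_char (cocycle m \<omega>) ` (dual_group - {trivial_char}) \<subseteq> dual_group - \<Gamma>))"

definition invariant_prob :: "'b measure \<Rightarrow> ('b \<Rightarrow> 'b) \<Rightarrow> bool"
  where "invariant_prob \<nu> T \<longleftrightarrow>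
    prob_space \<nu> \<and> T \<in> measurable \<nu> \<nu> \<and> distr \<nu> \<nu> T = \<nu>"

definition ergodic :: "'b measure \<Rightarrow> ('b \<Rightarrow> 'b) \<Rightarrow> bool"
  where "ergodic \<nu> T \<longleftrightarrow>
    invariant_prob \<nu> T \<and>
    (\<forall>A\<in>sets \<nu>. T -` A \<inter> space \<nu> = A \<longrightarrow> measure \<nu> A = 0 \<or> measure \<nu> A = 1)"

end

theory Submission
  imports Defs
begin

text \<open>
  Let \<open>A\<close> be \<open>S\<close>-invariant. Its section over \<open>\<omega>\<close> is the preimage, under the cocycle
  \<open>\<tau> = \<omega>\<^bsub>n-1\<^esub> \<circ> \<dots> \<circ> \<omega>\<^sub>0\<close>, of the section over \<open>\<sigma>\<^sup>n\<omega>\<close>. A character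
  outside the image of \<open>\<tau>\<^sup>*\<close> is nontrivial on the kernel of \<open>\<tau>\<close>, so it is orthogonal to the
  indicator of every \<open>\<tau>\<close>-preimage. Fourier tightness puts every nontrivial character in this
  position for large \<open>n\<close>, hence almost every section is null or conull. As epimorphisms preserve Haar
  measure, which of the two cases occurs is a \<open>\<sigma>\<close>-invariant property of \<open>\<omega>\<close>.

  That a Borel set without nontrivial Fourier coefficients is null or conull rests on the density of
  trigonometric polynomials, thus on the existence of enough characters. These are obtained
  variationally: for a fixed continuous kernel \<open>h\<close>, maximize the \<open>L\<^sup>2\<close>-norm of the convolution
  of \<open>h\<close> with the autocorrelation \<open>\<phi>\<close> of a unit vector \<open>g\<close>. Comparing \<open>g\<close> with
  \<open>g \<plusminus> c g(\<cdot> + y)\<close> shows that for near-maximizers \<open>\<phi>\<close> is almost multiplicative and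
  almost continuous at \<open>0\<close>, and by Tychonoff's theorem these functions have a character as cluster
  point.
\<close>

section \<open>Haar measure and correlations\<close>

lemma continuous_on_comp_UNIV:
  "continuous_on UNIV f \<Longrightarrow> continuous_on UNIV g \<Longrightarrow> continuous_on UNIV (\<lambda>x. f (g x))"
  by (rule continuous_on_compose2) auto

text \<open>Heine-Cantor from joint continuity: the distance of \<open>f (y + u)\<close> and
  \<open>f y\<close> vanishes at \<open>(x, 0)\<close>, so it is small on some
  \<open>V x \<times> W x\<close>. Finitely many \<open>V x\<close> cover the group, and the
  intersection of their \<open>W x\<close> works for all points.\<close>

lemma compact_group_uniformly_continuous:
  fixes f :: "'a :: topological_ab_group_add \<Rightarrow> 'b :: metric_space"
  assumes compact: "compact (UNIV :: 'a set)" and f: "continuous_on UNIV f" and "e > 0"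
  obtains U where "open U" "0 \<in> U" "\<And>x u. u \<in> U \<Longrightarrow> dist (f (x + u)) (f x) < e"
proof -
  have "\<exists>V W. open V \<and> open W \<and> x \<in> V \<and> 0 \<in> W \<and> (\<forall>y\<in>V. \<forall>u\<in>W. dist (f (y + u)) (f y) < e)" for x
  proof -
    have "open {p. dist (f (fst p + snd p)) (f (fst p)) < e}"
      by (intro open_Collect_less continuous_intros continuous_on_comp_UNIV[OF f])
    moreover have "(x, 0) \<in> {p. dist (f (fst p + snd p)) (f (fst p)) < e}"
      using \<open>e > 0\<close> by simp
    ultimately obtain V W where "open V" "open W" "(x, 0) \<in> V \<times> W"
      "V \<times> W \<subseteq> {p. dist (f (fst p + snd p)) (f (fst p)) < e}"
      by (rule open_prod_elim)
    then show ?thesis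
      by (intro exI[of _ V] exI[of _ W]) (auto simp: subset_iff)
  qed
  then obtain V W where VW: "\<And>x. open (V x)" "\<And>x. open (W x)" "\<And>x. x \<in> V x" "\<And>x. 0 \<in> W x"
    "\<And>x y u. y \<in> V x \<Longrightarrow> u \<in> W x \<Longrightarrow> dist (f (y + u)) (f y) < e"
    by metis
  obtain F where F: "finite F" "UNIV \<subseteq> (\<Union>x\<in>F. V x)"
    using compactE_image[OF compact, of UNIV V] VW(1,3) by (metis UNIV_I UN_I subsetI)
  show thesis
  proof
    show "open (\<Inter>x\<in>F. W x)" using F VW by blast
    show "0 \<in> (\<Inter>x\<in>F. W x)" using VW by blast
    show "dist (f (x + u)) (f x) < e" if "u \<in> (\<Inter>x\<in>F. W x)" for x u
      using F(2) VW(5)[of x _ u] that by (metis INT_iff UNIV_I UN_iff subsetD)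
  qed
qed

lemma continuous_on_groupI:
  fixes f :: "'a :: topological_ab_group_add \<Rightarrow> 'b :: metric_space"
  assumes "\<And>e. e > 0 \<Longrightarrow> \<exists>U. open U \<and> 0 \<in> U \<and> (\<forall>u\<in>U. \<forall>x. dist (f (x + u)) (f x) < e)"
  shows "continuous_on UNIV f"
proof -
  have "(f \<longlongrightarrow> f x) (at x)" for x
  proof (rule tendstoI)
    fix e :: real assume "e > 0"
    then obtain U where U: "open U" "0 \<in> U" "\<forall>u\<in>U. \<forall>x. dist (f (x + u)) (f x) < e"
      using assms by blast
    have "open ((\<lambda>y. y - x) -` U)"
      by (intro open_vimage U continuous_intros)
    moreover have "x \<in> (\<lambda>y. y - x) -` U" using U by simp
    moreover have "dist (f y) (f x) < e" if "y \<in> (\<lambda>y. y - x) -` U" for y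
      using U(3) that by (metis add.commute diff_add_cancel vimageE)
    ultimately show "\<forall>\<^sub>F y in at x. dist (f y) (f x) < e"
      unfolding eventually_at_topological by blast
  qed
  then show ?thesis by (simp add: continuous_on_def)
qed

section \<open>Integration against Haar measure\<close>

locale compact_haar =
  fixes m :: "('a :: {topological_ab_group_add, t2_space}) measure"
  assumes compact_UNIV: "compact (UNIV :: 'a set)"
    and haar: "haar_prob m"
begin

sublocale prob_space m
  using haar by (simp add: haar_prob_def)

lemma sets_haar [simp, measurable_cong]: "sets m = sets borel"
  using haar by (simp add: haar_prob_def)

lemma space_haar [simp]: "space m = UNIV"
  using sets_eq_imp_space_eq[OF sets_haar] by simp

lemma bounded_continuous:
  fixes f :: "'a \<Rightarrow> 'b :: real_normed_vector"
  assumes "continuous_on UNIV f"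
  shows "\<exists>B>0. \<forall>x. norm (f x) \<le> B"
proof -
  have "bounded (range f)"
    by (intro compact_imp_bounded compact_continuous_image assms compact_UNIV)
  then show ?thesis
    unfolding bounded_pos by auto
qed

lemma measurable_continuous:
  fixes f :: "'a \<Rightarrow> 'b :: topological_space"
  assumes "continuous_on UNIV f"
  shows "f \<in> borel_measurable m"
  using borel_measurable_continuous_onI[OF assms] by (simp cong: measurable_cong_sets)

lemma integrable_continuous:
  fixes f :: "'a \<Rightarrow> 'b :: {banach, second_countable_topology}"
  assumes "continuous_on UNIV f"
  shows "integrable m f"
proof -
  obtain B where "B > 0" "\<And>x. norm (f x) \<le> B"
    using bounded_continuous[OF assms] by blast
  then show ?thesis
    by (intro integrable_const_bound[of _ B] measurable_continuous assms) auto
qed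

lemma integral_translate:
  fixes f :: "'a \<Rightarrow> 'b :: {banach, second_countable_topology}"
  assumes f: "f \<in> borel_measurable borel"
  shows "(\<integral>x. f (x + a) \<partial>m) = integral\<^sup>L m f"
proof -
  have [measurable]: "(\<lambda>x. a + x) \<in> borel_measurable borel"
    by (intro borel_measurable_continuous_onI continuous_intros)
  have "integral\<^sup>L m f = integral\<^sup>L (distr m m (\<lambda>x. a + x)) f"
    using haar by (simp add: haar_prob_def)
  also have "\<dots> = (\<integral>x. f (a + x) \<partial>m)"
    using f by (intro integral_distr) measurable
  finally show ?thesis by (simp add: add.commute)
qed

text \<open>Haar measure has full support: finitely many translates of the open set where
  \<open>f\<close> exceeds \<open>f x0 / 2\<close> cover the group, so the corresponding translates
  of \<open>f\<close>, all with the same integral, add up to at least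
  \<open>f x0 / 2\<close>.\<close>

lemma integral_continuous_pos:
  fixes f :: "'a \<Rightarrow> real"
  assumes f: "continuous_on UNIV f" and nonneg: "\<And>x. f x \<ge> 0" and pos: "f x0 > 0"
  shows "(\<integral>x. f x \<partial>m) > 0"
proof -
  have "open ((\<lambda>x. f (x + a)) -` {f x0 / 2<..})" for a
    by (intro open_vimage continuous_on_comp_UNIV[OF f] continuous_intros)
  moreover have "UNIV \<subseteq> (\<Union>a. (\<lambda>x. f (x + a)) -` {f x0 / 2<..})"
  proof
    fix x
    show "x \<in> (\<Union>a. (\<lambda>x. f (x + a)) -` {f x0 / 2<..})"
      by (rule UN_I[of "x0 - x"]) (use pos in auto)
  qed
  ultimately obtain F where F: "finite F" "UNIV \<subseteq> (\<Union>a\<in>F. (\<lambda>x. f (x + a)) -` {f x0 / 2<..})"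
    using compactE_image[OF compact_UNIV, of UNIV "\<lambda>a. (\<lambda>x. f (x + a)) -` {f x0 / 2<..}"] by metis
  have le: "f x0 / 2 \<le> (\<Sum>a\<in>F. f (x + a))" for x
  proof -
    obtain a where "a \<in> F" "f x0 / 2 < f (x + a)" using F(2) by blast
    moreover have "f (x + a) \<le> (\<Sum>a\<in>F. f (x + a))"
      by (intro member_le_sum) (use F \<open>a \<in> F\<close> nonneg in auto)
    ultimately show ?thesis by linarith
  qed
  have int: "integrable m (\<lambda>x. f (x + a))" for a
    by (intro integrable_continuous continuous_on_comp_UNIV[OF f] continuous_intros)
  have "f x0 / 2 = (\<integral>x. f x0 / 2 \<partial>m)" using prob_space by simp
  also have "\<dots> \<le> (\<integral>x. (\<Sum>a\<in>F. f (x + a)) \<partial>m)"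
    by (intro integral_mono Bochner_Integration.integrable_sum int le) simp
  also have "\<dots> = (\<Sum>a\<in>F. \<integral>x. f (x + a) \<partial>m)"
    by (intro Bochner_Integration.integral_sum int)
  also have "\<dots> = of_nat (card F) * (\<integral>x. f x \<partial>m)"
    by (simp add: integral_translate borel_measurable_continuous_onI[OF f])
  finally have "0 < of_nat (card F) * (\<integral>x. f x \<partial>m)" using pos by linarith
  then show ?thesis by (simp add: zero_less_mult_iff)
qed

text \<open>Up to a reflection of \<open>h\<close> this is a convolution. No conjugate is taken, so
  the form is bilinear, and translating \<open>f\<close> translates the result.\<close>

definition corr :: "('a \<Rightarrow> complex) \<Rightarrow> ('a \<Rightarrow> complex) \<Rightarrow> 'a \<Rightarrow> complex"
  where "corr h f x = (\<integral>t. h t * f (x + t) \<partial>m)"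

definition sqnorm :: "('a \<Rightarrow> complex) \<Rightarrow> real"
  where "sqnorm f = (\<integral>x. (norm (f x))\<^sup>2 \<partial>m)"

lemma continuous_translate:
  "continuous_on UNIV f \<Longrightarrow> continuous_on UNIV (\<lambda>x :: 'a. f (x + a))"
  by (erule continuous_on_comp_UNIV) (intro continuous_intros)

lemma continuous_translate':
  "continuous_on UNIV f \<Longrightarrow> continuous_on UNIV (\<lambda>x :: 'a. f (a + x))"
  by (erule continuous_on_comp_UNIV) (intro continuous_intros)

text \<open>A non-integrable \<open>f\<close> is covered by the default value 0 of the integral,
  since \<open>B\<close> bounds a norm and is therefore nonnegative.\<close>

lemma norm_integral_le:
  fixes f :: "'a \<Rightarrow> 'b :: {banach, second_countable_topology}"
  assumes "\<And>x. norm (f x) \<le> B"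
  shows "norm (integral\<^sup>L m f) \<le> B"
proof -
  have "B \<ge> 0" using norm_ge_zero assms by (rule order_trans)
  show ?thesis
  proof (cases "integrable m f")
    case True
    have "norm (integral\<^sup>L m f) \<le> (\<integral>x. norm (f x) \<partial>m)" by (rule integral_norm_bound)
    also have "\<dots> \<le> (\<integral>x. B \<partial>m)" by (intro integral_mono) (use True assms in auto)
    finally show ?thesis using prob_space by simp
  qed (simp add: not_integrable_integral_eq \<open>B \<ge> 0\<close>)
qed

lemma integrable_corr:
  fixes h f :: "'a \<Rightarrow> complex"
  shows "continuous_on UNIV h \<Longrightarrow> continuous_on UNIV f \<Longrightarrow> integrable m (\<lambda>t. h t * f (x + t))"
  by (intro integrable_continuous continuous_on_mult continuous_translate')

lemma continuous_corr:
  assumes h: "continuous_on UNIV h" and f: "continuous_on UNIV f"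
  shows "continuous_on UNIV (corr h f)"
proof (rule continuous_on_groupI)
  fix e :: real assume "e > 0"
  obtain B where B: "B > 0" "\<And>x. norm (h x) \<le> B" using bounded_continuous[OF h] by blast
  \<comment> \<open>The factor 2 turns the non-strict bound for the integral into a strict
    inequality with \<open>e\<close>.\<close>
  obtain U where U: "open U" "0 \<in> U" "\<And>x u. u \<in> U \<Longrightarrow> dist (f (x + u)) (f x) < e / (2 * B)"
    using compact_group_uniformly_continuous[OF compact_UNIV f, of "e / (2 * B)"] B \<open>e > 0\<close> by auto
  have "dist (corr h f (x + u)) (corr h f x) < e" if "u \<in> U" for x u
  proof -
    have "dist (corr h f (x + u)) (corr h f x) = norm (\<integral>t. h t * (f ((x + t) + u) - f (x + t)) \<partial>m)"
      unfolding corr_def dist_norm Bochner_Integration.integral_diff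
          [OF integrable_corr[OF h f] integrable_corr[OF h f], symmetric]
      by (simp add: algebra_simps)
    also have "\<dots> \<le> B * (e / (2 * B))"
    proof (rule norm_integral_le)
      fix t
      show "norm (h t * (f ((x + t) + u) - f (x + t))) \<le> B * (e / (2 * B))"
        unfolding norm_mult using B U(3)[OF that, of "x + t"]
        by (intro mult_mono) (auto simp: dist_norm)
    qed
    also have "\<dots> < e" using B \<open>e > 0\<close> by simp
    finally show ?thesis .
  qed
  then show "\<exists>U. open U \<and> 0 \<in> U \<and> (\<forall>u\<in>U. \<forall>x. dist (corr h f (x + u)) (corr h f x) < e)"
    using U by blast
qed

lemma sqnorm_nonneg [simp]: "sqnorm f \<ge> 0"
  by (simp add: sqnorm_def)

lemma integrable_sqnorm: "continuous_on UNIV f \<Longrightarrow> integrable m (\<lambda>x. (norm (f x :: complex))\<^sup>2)"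
  by (intro integrable_continuous continuous_intros)

lemma sqnorm_translate:
  "continuous_on UNIV f \<Longrightarrow> sqnorm (\<lambda>x. f (x + a)) = sqnorm f"
  unfolding sqnorm_def
  by (rule integral_translate[of "\<lambda>x. (norm (f x))\<^sup>2"])
    (intro borel_measurable_continuous_onI continuous_intros)

lemma sqnorm_scale: "sqnorm (\<lambda>x. c * f x) = (norm c)\<^sup>2 * sqnorm f"
  by (simp add: sqnorm_def norm_mult power_mult_distrib)

lemma sqnorm_le:
  assumes "\<And>x. norm (f x) \<le> B"
  shows "sqnorm f \<le> B\<^sup>2"
proof -
  have "norm (\<integral>x. (norm (f x))\<^sup>2 \<partial>m) \<le> B\<^sup>2"
    by (rule norm_integral_le) (use assms in \<open>auto intro!: power_mono\<close>)
  then show ?thesis by (simp add: sqnorm_def)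
qed

text \<open>The crude factor 2 avoids the square roots of the Minkowski inequality; its repeated use
  produces the constants 4, 8 and 40 in the estimates for near-maximizers.\<close>

lemma sqnorm_add_le:
  assumes f: "continuous_on UNIV f" and g: "continuous_on UNIV g"
  shows "sqnorm (\<lambda>x. f x + g x) \<le> 2 * sqnorm f + 2 * sqnorm g"
proof -
  have "(norm (a + b))\<^sup>2 \<le> 2 * (norm a)\<^sup>2 + 2 * (norm b)\<^sup>2" for a b :: complex
  proof -
    have "(norm (a + b))\<^sup>2 \<le> (norm a + norm b)\<^sup>2" by (intro power_mono norm_triangle_ineq) simp
    also have "\<dots> \<le> 2 * (norm a)\<^sup>2 + 2 * (norm b)\<^sup>2"
      using sum_squares_bound[of "norm a" "norm b"] by (simp add: power2_sum)
    finally show ?thesis .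
  qed
  then have "sqnorm (\<lambda>x. f x + g x) \<le> (\<integral>x. 2 * (norm (f x))\<^sup>2 + 2 * (norm (g x))\<^sup>2 \<partial>m)"
    unfolding sqnorm_def
    by (intro integral_mono integrable_continuous continuous_intros f g) auto
  also have "\<dots> = 2 * sqnorm f + 2 * sqnorm g"
    unfolding sqnorm_def
    by (subst Bochner_Integration.integral_add) (auto intro!: integrable_continuous continuous_intros f g)
  finally show ?thesis .
qed

section \<open>Near-maximizers of the correlation functional\<close>

lemma corr_translate: "corr h f (x + a) = corr h (\<lambda>z. f (z + a)) x"
  by (simp add: corr_def ac_simps)

lemma corr_translate_left:
  assumes "continuous_on UNIV h" "continuous_on UNIV f"
  shows "corr (\<lambda>t. h (t + a)) f x = corr h f (x - a)"
proof -
  have "(\<lambda>t. h t * f (x - a + t)) \<in> borel_measurable borel"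
    by (intro borel_measurable_continuous_onI continuous_on_mult continuous_translate' assms)
  from integral_translate[OF this, of a] show ?thesis
    by (simp add: corr_def algebra_simps)
qed

lemma corr_add_left:
  assumes "continuous_on UNIV h" "continuous_on UNIV k" "continuous_on UNIV f"
  shows "corr (\<lambda>t. h t + c * k t) f x = corr h f x + c * corr k f x"
proof -
  have "corr (\<lambda>t. h t + c * k t) f x = (\<integral>t. h t * f (x + t) + c * (k t * f (x + t)) \<partial>m)"
    by (simp add: corr_def algebra_simps)
  also have "\<dots> = corr h f x + c * corr k f x"
    by (simp add: corr_def integrable_corr assms)
  finally show ?thesis .
qed

lemma corr_add_right:
  assumes "continuous_on UNIV h" "continuous_on UNIV f" "continuous_on UNIV k"
  shows "corr h (\<lambda>t. f t + c * k t) x = corr h f x + c * corr h k x"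
proof -
  have "corr h (\<lambda>t. f t + c * k t) x = (\<integral>t. h t * f (x + t) + c * (h t * k (x + t)) \<partial>m)"
    by (simp add: corr_def algebra_simps)
  also have "\<dots> = corr h f x + c * corr h k x"
    by (simp add: corr_def integrable_corr assms)
  finally show ?thesis .
qed

text \<open>The inner product of \<open>g\<close> with its translates: a positive definite function
  whose Fourier coefficients are the squared absolute values of those of \<open>g\<close>. For a
  character \<open>g\<close> it is \<open>g\<close> itself.\<close>

definition acorr :: "('a \<Rightarrow> complex) \<Rightarrow> 'a \<Rightarrow> complex"
  where "acorr g = corr (\<lambda>t. cnj (g t)) g"

lemma continuous_acorr: "continuous_on UNIV g \<Longrightarrow> continuous_on UNIV (acorr g)"
  unfolding acorr_def by (intro continuous_corr continuous_intros)

lemma acorr_zero: "acorr g 0 = of_real (sqnorm g)"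
  by (simp add: acorr_def corr_def sqnorm_def complex_norm_square mult.commute
      del: of_real_power flip: integral_complex_of_real)

text \<open>The inequality of arithmetic and geometric means can replace Cauchy-Schwarz, because a
  translate of \<open>g\<close> has the same \<open>sqnorm\<close>.\<close>

lemma norm_acorr_le:
  assumes g: "continuous_on UNIV g"
  shows "norm (acorr g y) \<le> sqnorm g"
proof -
  have gy: "continuous_on UNIV (\<lambda>t. g (t + y))" using g by (rule continuous_translate)
  have "norm (acorr g y) \<le> (\<integral>t. norm (cnj (g t) * g (t + y)) \<partial>m)"
    unfolding acorr_def corr_def add.commute[of y] by (rule integral_norm_bound)
  also have "\<dots> \<le> (\<integral>t. ((norm (g t))\<^sup>2 + (norm (g (t + y)))\<^sup>2) / 2 \<partial>m)"
  proof (intro integral_mono integrable_continuous continuous_intros g gy)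
    show "norm (cnj (g t) * g (t + y)) \<le> ((norm (g t))\<^sup>2 + (norm (g (t + y)))\<^sup>2) / 2" for t
      using sum_squares_bound[of "norm (g t)" "norm (g (t + y))"] by (simp add: norm_mult)
  qed simp
  also have "\<dots> = (sqnorm g + sqnorm (\<lambda>t. g (t + y))) / 2"
    unfolding sqnorm_def by (simp add: integrable_sqnorm g gy)
  also have "\<dots> = sqnorm g" using sqnorm_translate[OF g] by simp
  finally show ?thesis .
qed

lemma acorr_minus:
  assumes g: "continuous_on UNIV g"
  shows "acorr g (- y) = cnj (acorr g y)"
proof -
  have "(\<lambda>t. cnj (g t) * g (- y + t)) \<in> borel_measurable borel"
    by (intro borel_measurable_continuous_onI continuous_on_mult continuous_on_cnj continuous_translate' g)
  from integral_translate[OF this, of y]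
  have "acorr g (- y) = (\<integral>t. cnj (cnj (g t) * g (y + t)) \<partial>m)"
    by (simp add: acorr_def corr_def ac_simps)
  also have "\<dots> = cnj (acorr g y)"
    unfolding acorr_def corr_def by (rule Bochner_Integration.integral_cnj)
  finally show ?thesis .
qed

text \<open>The effect of the trial perturbation: on expanding the sesquilinear form, the two
  diagonal terms coincide by translation invariance and \<open>cnj c * c = 1\<close>.\<close>

lemma acorr_add_translate:
  assumes g: "continuous_on UNIV g" and c: "norm c = 1"
  shows "acorr (\<lambda>t. g t + c * g (t + y)) z
    = 2 * acorr g z + c * acorr g (z + y) + cnj c * acorr g (z - y)"
proof -
  have gy: "continuous_on UNIV (\<lambda>t. g (t + y))" using g by (rule continuous_translate)
  have cg: "continuous_on UNIV (\<lambda>t. cnj (g t))" "continuous_on UNIV (\<lambda>t. cnj (g (t + y)))"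
    by (intro continuous_intros g gy)+
  have f: "continuous_on UNIV (\<lambda>t. g t + c * g (t + y))"
    by (intro continuous_intros g gy)
  have cc: "cnj c * c = 1" using c by (simp add: complex_norm_square[symmetric] mult.commute)
  have "acorr (\<lambda>t. g t + c * g (t + y)) z
      = corr (\<lambda>t. cnj (g t) + cnj c * cnj (g (t + y))) (\<lambda>t. g t + c * g (t + y)) z"
    by (simp add: acorr_def)
  also have "\<dots> = corr (\<lambda>t. cnj (g t)) g z + c * corr (\<lambda>t. cnj (g t)) (\<lambda>t. g (t + y)) z
      + cnj c * (corr (\<lambda>t. cnj (g (t + y))) g z + c * corr (\<lambda>t. cnj (g (t + y))) (\<lambda>t. g (t + y)) z)"
    by (simp only: corr_add_left[OF cg f] corr_add_right[OF cg(1) g gy] corr_add_right[OF cg(2) g gy])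
  also have "corr (\<lambda>t. cnj (g t)) (\<lambda>t. g (t + y)) z = acorr g (z + y)"
    by (simp add: acorr_def corr_translate)
  also have "corr (\<lambda>t. cnj (g (t + y))) g z = acorr g (z - y)"
    unfolding acorr_def by (rule corr_translate_left[OF cg(1) g])
  also have "corr (\<lambda>t. cnj (g (t + y))) (\<lambda>t. g (t + y)) z = acorr g z"
    unfolding acorr_def corr_translate[symmetric]
    by (subst corr_translate_left[OF cg(1) g]) simp
  finally show ?thesis using cc by (simp add: acorr_def algebra_simps)
qed

text \<open>At \<open>r = 0\<close> this is the parallelogram law. The weights satisfy \<open>(1 -
  r) / 2 * (1 + r)\<^sup>2 + (1 + r) / 2 * (1 - r)\<^sup>2 = 1 - r\<^sup>2\<close>, which matches
  the coefficient of the last term.\<close>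

lemma parallelogram_identity:
  fixes a b :: complex and r :: real
  shows "(norm (b - of_real r * a))\<^sup>2
    = (1 - r) / 2 * (norm (a + b))\<^sup>2 + (1 + r) / 2 * (norm (a - b))\<^sup>2 - (1 - r\<^sup>2) * (norm a)\<^sup>2"
  unfolding cmod_power2 by (simp add: power2_eq_square field_simps)

section \<open>Estimates for a unit vector that attains the bound \<open>M\<close> up to
  \<open>e\<close>\<close>

context
  fixes h g :: "'a \<Rightarrow> complex" and M e :: real
  assumes h: "continuous_on UNIV h" and g: "continuous_on UNIV g"
    and M: "\<And>g. continuous_on UNIV g \<Longrightarrow> sqnorm (corr h (acorr g)) \<le> M * (sqnorm g)\<^sup>2"
    and g1: "sqnorm g = 1" and near: "M - e \<le> sqnorm (corr h (acorr g))"
begin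

private abbreviation (input) "\<phi> \<equiv> acorr g"
private abbreviation (input) "\<psi> \<equiv> corr h (acorr g)"

private lemma cont_psi: "continuous_on UNIV \<psi>"
  by (intro continuous_corr continuous_acorr h g)

private lemma cont_psi_translate: "continuous_on UNIV (\<lambda>x. \<psi> (x + y))"
  by (rule continuous_translate[OF cont_psi])

private lemma cont_psi_minus: "continuous_on UNIV (\<lambda>x. \<psi> (x - y))"
  using cont_psi_translate[of "- y"] by simp

text \<open>The bound \<open>M\<close> is applied to the trial function
  \<open>g t + c * g (t + y)\<close>. Its correlation is twice the combination on the left, and its
  \<open>sqnorm\<close> is \<open>2 + 2 * Re (c * \<phi> y)\<close>; a factor 4 cancels.\<close>

private lemma sqnorm_add_combination:
  assumes c: "norm c = 1"
  shows "sqnorm (\<lambda>x. \<psi> x + (c * \<psi> (x + y) + cnj c * \<psi> (x - y)) / 2) \<le> M * (1 + Re (c * \<phi> y))\<^sup>2"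
proof -
  define gc where "gc = (\<lambda>t. g t + c * g (t + y))"
  have gc: "continuous_on UNIV gc"
    unfolding gc_def by (intro continuous_intros g continuous_translate)
  have cp: "continuous_on UNIV \<phi>" "continuous_on UNIV (\<lambda>z. \<phi> (z + y))" "continuous_on UNIV (\<lambda>z. \<phi> (z + (- y)))"
    by (intro continuous_acorr continuous_translate g)+
  \<comment> \<open>The leading \<open>0\<close> and the shift by \<open>- y\<close> bring each
    summand into the shape \<open>f t + c * k t\<close>, so that \<open>corr_add_right\<close> peels
    them off one by one.\<close>
  have "acorr gc = (\<lambda>z. (0 + 2 * \<phi> z + c * \<phi> (z + y)) + cnj c * \<phi> (z + (- y)))"
    unfolding gc_def by (auto simp: acorr_add_translate[OF g c])
  then have "corr h (acorr gc) x = corr h (\<lambda>z. (0 + 2 * \<phi> z + c * \<phi> (z + y)) + cnj c * \<phi> (z + (- y))) x" for x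
    by simp
  also have "\<dots> x = 2 * (\<psi> x + (c * \<psi> (x + y) + cnj c * \<psi> (x - y)) / 2)" for x
  proof -
    have "corr h (\<lambda>z. 0) x = 0" by (simp add: corr_def)
    then show ?thesis
      using corr_translate[of h \<phi> x y] corr_translate[of h \<phi> x "- y"]
      by (subst corr_add_right, (intro continuous_intros h cp)+)+ (simp add: field_simps)
  qed
  finally have "corr h (acorr gc) = (\<lambda>x. 2 * (\<psi> x + (c * \<psi> (x + y) + cnj c * \<psi> (x - y)) / 2))"
    by blast
  then have "4 * sqnorm (\<lambda>x. \<psi> x + (c * \<psi> (x + y) + cnj c * \<psi> (x - y)) / 2) = sqnorm (corr h (acorr gc))"
    by (simp only: sqnorm_scale) simp
  also have "\<dots> \<le> M * (sqnorm gc)\<^sup>2" by (rule M[OF gc])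
  also have "sqnorm gc = 2 + 2 * Re (c * \<phi> y)"
  proof -
    have "complex_of_real (sqnorm gc) = 2 + (c * \<phi> y + cnj (c * \<phi> y))"
      using acorr_add_translate[OF g c, of y 0] acorr_minus[OF g, of y]
      by (simp add: acorr_zero g1 gc_def[symmetric])
    then show ?thesis by (simp only: complex_add_cnj) (metis Re_complex_of_real of_real_add of_real_numeral)
  qed
  also have "M * (2 + 2 * Re (c * \<phi> y))\<^sup>2 = 4 * (M * (1 + Re (c * \<phi> y))\<^sup>2)"
    by (simp add: power2_eq_square algebra_simps)
  finally show ?thesis by simp
qed

private lemma excess_nonneg: "e \<ge> 0"
  using M[OF g] near g1 by simp

text \<open>If \<^term>\<open>\<eta>\<close> is the average of the two translates, then the squared norms of
  \<open>\<psi> + \<eta>\<close> and \<open>\<psi> - \<eta>\<close> are at most \<^term>\<open>M * (1 + r)\<^sup>2\<close> and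
  \<^term>\<open>M * (1 - r)\<^sup>2\<close>; in the weighted parallelogram identity these bounds leave only the
  excess \<^term>\<open>e\<close>.\<close>

private lemma near_eigenvector_Re:
  assumes c: "norm c = 1"
  shows "sqnorm (\<lambda>x. (c * \<psi> (x + y) + cnj c * \<psi> (x - y)) / 2 - of_real (Re (c * \<phi> y)) * \<psi> x) \<le> e"
proof -
  define r where "r = Re (c * \<phi> y)"
  define \<eta> where "\<eta> = (\<lambda>x. (c * \<psi> (x + y) + cnj c * \<psi> (x - y)) / 2)"
  have cont: "continuous_on UNIV \<eta>"
    unfolding \<eta>_def by (intro continuous_intros cont_psi_translate cont_psi_minus) simp
  have "norm (c * \<phi> y) \<le> 1"
    using norm_acorr_le[OF g, of y] by (simp add: norm_mult c g1)
  then have r: "\<bar>r\<bar> \<le> 1"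
    unfolding r_def using abs_Re_le_cmod order_trans by blast
  have plus: "sqnorm (\<lambda>x. \<psi> x + \<eta> x) \<le> M * (1 + r)\<^sup>2"
    unfolding \<eta>_def r_def by (rule sqnorm_add_combination[OF c])
  have neg: "1 + Re ((- c) * \<phi> y) = 1 - r"
    by (simp add: r_def)
  have minus: "sqnorm (\<lambda>x. \<psi> x - \<eta> x) \<le> M * (1 - r)\<^sup>2"
  proof -
    have "(\<lambda>x. \<psi> x - \<eta> x) = (\<lambda>x. \<psi> x + ((- c) * \<psi> (x + y) + cnj (- c) * \<psi> (x - y)) / 2)"
      by (auto simp: \<eta>_def field_simps)
    then show ?thesis
      using sqnorm_add_combination[of "- c" y, unfolded neg] c by simp
  qed
  have "sqnorm (\<lambda>x. \<eta> x - of_real r * \<psi> x) =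
      (1 - r) / 2 * sqnorm (\<lambda>x. \<psi> x + \<eta> x) + (1 + r) / 2 * sqnorm (\<lambda>x. \<psi> x - \<eta> x) - (1 - r\<^sup>2) * sqnorm \<psi>"
    unfolding sqnorm_def parallelogram_identity
    by (simp add: integrable_sqnorm cont cont_psi continuous_on_add continuous_on_diff)
  also have "\<dots> \<le> (1 - r) / 2 * (M * (1 + r)\<^sup>2) + (1 + r) / 2 * (M * (1 - r)\<^sup>2) - (1 - r\<^sup>2) * (M - e)"
    using r by (intro add_mono diff_mono mult_left_mono plus minus near) (auto simp: abs_square_le_1)
  also have "\<dots> = (1 - r\<^sup>2) * e"
    by (simp add: power2_eq_square field_simps)
  also have "\<dots> \<le> 1 * e"
    by (intro mult_right_mono excess_nonneg) simp
  finally show ?thesis by (simp add: \<eta>_def r_def)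
qed

text \<open>The choices \<open>c = 1\<close> and \<open>c = - \<i>\<close> isolate the symmetric and
  the antisymmetric combination of the two translates, together with the real and the imaginary part
  of \<open>\<phi> y\<close>. Recombined, they make \<open>\<psi>\<close> an approximate
  eigenfunction of translation by \<open>y\<close> with eigenvalue \<open>\<phi> y\<close>.\<close>

lemma near_eigenvector: "sqnorm (\<lambda>x. \<psi> (x + y) - \<phi> y * \<psi> x) \<le> 4 * e"
proof -
  define u where "u = (\<lambda>c x. (c * \<psi> (x + y) + cnj c * \<psi> (x - y)) / 2 - of_real (Re (c * \<phi> y)) * \<psi> x)"
  have u: "continuous_on UNIV (u c)" for c
    unfolding u_def by (intro continuous_intros cont_psi cont_psi_translate cont_psi_minus) simp
  have "\<psi> (x + y) - \<phi> y * \<psi> x = u 1 x + \<i> * u (- \<i>) x" for x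
    by (simp add: u_def complex_eq_iff field_simps)
  then have "sqnorm (\<lambda>x. \<psi> (x + y) - \<phi> y * \<psi> x) \<le> 2 * sqnorm (u 1) + 2 * sqnorm (\<lambda>x. \<i> * u (- \<i>) x)"
    by (simp only:) (intro sqnorm_add_le u continuous_intros)
  also have "\<dots> = 2 * sqnorm (u 1) + 2 * sqnorm (u (- \<i>))"
    by (simp add: sqnorm_scale)
  also have "\<dots> \<le> 2 * e + 2 * e"
    using near_eigenvector_Re[of 1 y] near_eigenvector_Re[of "- \<i>" y] unfolding u_def
    by (intro add_mono mult_left_mono) simp_all
  finally show ?thesis by simp
qed

text \<open>Translation by \<open>y + z\<close> is carried out at once and in two steps; this almost
  multiplies \<open>\<psi>\<close> by \<open>\<phi> (y + z)\<close> and by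
  \<open>\<phi> y * \<phi> z\<close> respectively. The constant is
  \<open>40 = 2 * 4 + 2 * (2 * 4 + 2 * 4)\<close>.\<close>

lemma near_multiplicative: "(norm (\<phi> (y + z) - \<phi> y * \<phi> z))\<^sup>2 * sqnorm \<psi> \<le> 40 * e"
proof -
  define v where "v = (\<lambda>y x. \<psi> (x + y) - \<phi> y * \<psi> x)"
  have v: "continuous_on UNIV (v y)" for y
    unfolding v_def by (intro continuous_intros cont_psi cont_psi_translate)
  have sq: "sqnorm (v y) \<le> 4 * e" for y
    unfolding v_def by (rule near_eigenvector)
  have "(norm (\<phi> z))\<^sup>2 \<le> 1"
    using norm_acorr_le[OF g, of z] by (simp add: g1 power_le_one)
  then have z: "(norm (\<phi> z))\<^sup>2 * sqnorm (v y) \<le> 1 * (4 * e)"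
    by (intro mult_mono sq) auto
  have "(norm (\<phi> (y + z) - \<phi> y * \<phi> z))\<^sup>2 * sqnorm \<psi>
      = sqnorm (\<lambda>x. (- 1) * v (y + z) x + (v z (x + y) + \<phi> z * v y x))"
    unfolding sqnorm_scale[symmetric] by (simp add: v_def algebra_simps)
  also have "\<dots> \<le> 2 * sqnorm (\<lambda>x. (- 1) * v (y + z) x) + 2 * sqnorm (\<lambda>x. v z (x + y) + \<phi> z * v y x)"
    by (intro sqnorm_add_le continuous_intros v continuous_translate[OF v])
  also have "sqnorm (\<lambda>x. v z (x + y) + \<phi> z * v y x)
      \<le> 2 * sqnorm (\<lambda>x. v z (x + y)) + 2 * sqnorm (\<lambda>x. \<phi> z * v y x)"
    by (intro sqnorm_add_le continuous_intros v continuous_translate[OF v])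
  finally show ?thesis
    using sq[of "y + z"] sq[of z] z unfolding sqnorm_scale sqnorm_translate[OF v] by simp
qed

text \<open>As \<open>\<phi>\<close> is bounded by 1, moving \<open>h\<close> by \<open>y\<close>
  changes \<open>\<psi>\<close> by at most \<open>d\<close>, while translation almost multiplies
  \<open>\<psi>\<close> by \<open>\<phi> y\<close>. The estimate sees \<open>g\<close> only through
  \<open>e\<close> and \<open>sqnorm \<psi>\<close>; this uniformity at \<open>0\<close> makes the
  limit function continuous.\<close>

lemma near_one:
  assumes d: "\<And>t. norm (h (t - y) - h t) \<le> d"
  shows "(norm (\<phi> y - 1))\<^sup>2 * sqnorm \<psi> \<le> 8 * e + 2 * d\<^sup>2"
proof -
  have hy: "continuous_on UNIV (\<lambda>t. h (t - y))"
    using continuous_translate[OF h, of "- y"] by simp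
  have "norm (\<psi> (x + y) - \<psi> x) \<le> d" for x
  proof -
    have "\<psi> (x + y) - \<psi> x = corr (\<lambda>t. h (t - y) + (- 1) * h t) \<phi> x"
      using corr_translate_left[OF h continuous_acorr[OF g], of "- y" x]
      by (subst corr_add_left[OF hy h continuous_acorr[OF g]]) simp
    also have "norm \<dots> \<le> d"
      unfolding corr_def
    proof (rule norm_integral_le)
      fix t
      have "norm ((h (t - y) + (- 1) * h t) * \<phi> (x + t)) \<le> d * 1"
        unfolding norm_mult using d[of t] norm_acorr_le[OF g, of "x + t"]
        by (intro mult_mono) (auto simp: g1 intro: order_trans[OF norm_ge_zero])
      then show "norm ((h (t - y) + (- 1) * h t) * \<phi> (x + t)) \<le> d" by simp
    qed
    finally show ?thesis .
  qed
  then have diff: "sqnorm (\<lambda>x. \<psi> (x + y) - \<psi> x) \<le> d\<^sup>2" by (rule sqnorm_le)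
  have "(norm (\<phi> y - 1))\<^sup>2 * sqnorm \<psi>
      = sqnorm (\<lambda>x. (- 1) * (\<psi> (x + y) - \<phi> y * \<psi> x) + (\<psi> (x + y) - \<psi> x))"
    unfolding sqnorm_scale[symmetric] by (simp add: algebra_simps)
  also have "\<dots> \<le> 2 * sqnorm (\<lambda>x. (- 1) * (\<psi> (x + y) - \<phi> y * \<psi> x)) + 2 * sqnorm (\<lambda>x. \<psi> (x + y) - \<psi> x)"
    by (intro sqnorm_add_le continuous_intros cont_psi cont_psi_translate)
  finally show ?thesis
    using near_eigenvector[of y] diff unfolding sqnorm_scale by simp
qed

text \<open>For this \<open>h\<close>, \<open>\<psi>\<close> is the difference of
  \<open>\<omega> = corr k \<phi>\<close> and a translate of it. Moving the translation to the other
  factor of the inner product bounds \<open>sqnorm \<psi>\<close> by the mean of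
  \<open>norm (\<psi> (x + a) - \<psi> x)\<close>. Hence translation by \<open>a\<close> moves
  \<open>\<psi>\<close> noticeably, which keeps \<open>\<phi> a\<close> away from 1.\<close>

lemma not_near_one:
  assumes k: "continuous_on UNIV k" "\<And>t. norm (k t) \<le> 1" and hk: "h = (\<lambda>t. k t - k (t + a))"
  shows "(sqnorm \<psi>)\<^sup>2 \<le> 8 * e + 2 * (norm (\<phi> a - 1))\<^sup>2 * sqnorm \<psi>"
proof -
  define \<omega> where "\<omega> = corr k \<phi>"
  have \<omega>: "continuous_on UNIV \<omega>"
    unfolding \<omega>_def by (intro continuous_corr k continuous_acorr g)
  have \<omega>_le: "norm (\<omega> x) \<le> 1" for x
    unfolding \<omega>_def corr_def
  proof (rule norm_integral_le)
    show "norm (k t * \<phi> (x + t)) \<le> 1" for t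
      using k(2)[of t] norm_acorr_le[OF g, of "x + t"] by (simp add: norm_mult g1 mult_le_one)
  qed
  have \<psi>_eq: "\<psi> x = \<omega> x - \<omega> (x - a)" for x
    using corr_add_left[OF k(1) continuous_translate[OF k(1)] continuous_acorr[OF g], of "- 1" a x]
      corr_translate_left[OF k(1) continuous_acorr[OF g], of a x]
    by (simp add: \<omega>_def hk)
  define u where "u = (\<lambda>x. \<psi> (x + a) - \<psi> x)"
  have u: "continuous_on UNIV u"
    unfolding u_def by (intro continuous_intros cont_psi cont_psi_translate)
  have int: "integrable m (\<lambda>x. \<psi> x * cnj (\<omega> x))" "integrable m (\<lambda>x. \<psi> x * cnj (\<omega> (x - a)))"
      "integrable m (\<lambda>x. \<psi> (x + a) * cnj (\<omega> x))"
    using continuous_translate[OF \<omega>, of "- a"]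
    by (intro integrable_continuous continuous_intros cont_psi cont_psi_translate \<omega>; simp)+
  have tr: "(\<integral>x. \<psi> x * cnj (\<omega> (x - a)) \<partial>m) = (\<integral>x. \<psi> (x + a) * cnj (\<omega> x) \<partial>m)"
  proof -
    have "(\<lambda>x. \<psi> x * cnj (\<omega> (x - a))) \<in> borel_measurable borel"
      using continuous_translate[OF \<omega>, of "- a"]
      by (intro borel_measurable_continuous_onI continuous_intros cont_psi) simp
    from integral_translate[OF this, of a] show ?thesis by simp
  qed
  have "complex_of_real (sqnorm \<psi>) = (\<integral>x. \<psi> x * cnj (\<psi> x) \<partial>m)"
    by (simp add: sqnorm_def complex_norm_square del: of_real_power flip: integral_complex_of_real)
  also have "\<dots> = (\<integral>x. \<psi> x * cnj (\<omega> x) - \<psi> x * cnj (\<omega> (x - a)) \<partial>m)"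
    by (intro Bochner_Integration.integral_cong refl) (subst (2) \<psi>_eq, simp add: algebra_simps)
  also have "\<dots> = (\<integral>x. - u x * cnj (\<omega> x) \<partial>m)"
  proof -
    have "- u x * cnj (\<omega> x) = \<psi> x * cnj (\<omega> x) - \<psi> (x + a) * cnj (\<omega> x)" for x
      by (simp add: u_def algebra_simps)
    then show ?thesis using int tr by simp
  qed
  finally have "sqnorm \<psi> = norm (\<integral>x. - u x * cnj (\<omega> x) \<partial>m)"
    by (metis abs_of_nonneg norm_of_real sqnorm_nonneg)
  also have "\<dots> \<le> (\<integral>x. norm (- u x * cnj (\<omega> x)) \<partial>m)" by (rule integral_norm_bound)
  also have "\<dots> \<le> (\<integral>x. norm (u x) \<partial>m)"
    using \<omega>_le by (intro integral_mono integrable_continuous continuous_intros u \<omega>)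
      (simp add: norm_mult mult_left_le)
  \<comment> \<open>The extra factor prepares for
    \<open>2 * s * t \<le> s\<^sup>2 + t\<^sup>2\<close> under the integral, with constant
    \<open>s\<close>, in the role of Cauchy-Schwarz.\<close>
  finally have "2 * sqnorm \<psi> * sqnorm \<psi> \<le> 2 * sqnorm \<psi> * (\<integral>x. norm (u x) \<partial>m)"
    by (intro mult_left_mono) auto
  also have "\<dots> = (\<integral>x. 2 * sqnorm \<psi> * norm (u x) \<partial>m)" by simp
  also have "\<dots> \<le> (\<integral>x. (sqnorm \<psi>)\<^sup>2 + (norm (u x))\<^sup>2 \<partial>m)"
    by (intro integral_mono integrable_continuous continuous_intros u sum_squares_bound)
  also have "\<dots> = (sqnorm \<psi>)\<^sup>2 + sqnorm u"
    using prob_space by (simp add: integrable_sqnorm u flip: sqnorm_def)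
  finally have "(sqnorm \<psi>)\<^sup>2 \<le> sqnorm u" by (simp add: power2_eq_square)
  also have "sqnorm u = sqnorm (\<lambda>x. (\<psi> (x + a) - \<phi> a * \<psi> x) + (\<phi> a - 1) * \<psi> x)"
    by (simp add: u_def algebra_simps)
  also have "\<dots> \<le> 2 * sqnorm (\<lambda>x. \<psi> (x + a) - \<phi> a * \<psi> x) + 2 * sqnorm (\<lambda>x. (\<phi> a - 1) * \<psi> x)"
    by (intro sqnorm_add_le continuous_intros cont_psi cont_psi_translate)
  finally show ?thesis
    using near_eigenvector[of a] unfolding sqnorm_scale by simp
qed

end

section \<open>Characters separate points\<close>

lemma urysohn_function:
  fixes S T :: "'a set"
  assumes "closed S" "closed T" "S \<inter> T = {}"
  obtains f :: "'a \<Rightarrow> real" where "continuous_on UNIV f" "\<And>x. 0 \<le> f x" "\<And>x. f x \<le> 1"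
    "\<And>x. x \<in> S \<Longrightarrow> f x = 0" "\<And>x. x \<in> T \<Longrightarrow> f x = 1"
proof -
  have "compact_space (euclidean :: 'a topology)"
    using compact_UNIV by (simp add: compact_space_def compactin_euclidean_iff)
  moreover have "Hausdorff_space (euclidean :: 'a topology)"
    unfolding Hausdorff_space_def disjnt_def by simp (metis hausdorff)
  ultimately have "normal_space (euclidean :: 'a topology)"
    by (simp add: compact_Hausdorff_or_regular_imp_normal_space)
  then obtain f where f: "continuous_map euclidean (top_of_set {0..1::real}) f" "f ` S \<subseteq> {0}" "f ` T \<subseteq> {1}"
    using Urysohn_lemma[of "euclidean :: 'a topology" S T 0 1] assms
    by (auto simp: disjnt_def)
  then have "continuous_on UNIV f" "\<And>x. f x \<in> {0..1}"
    by (auto simp: continuous_map_in_subtopology)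
  then show thesis
    using f(2,3) by (intro that[of f]) force+
qed

lemma acorr_scale: "acorr (\<lambda>t. of_real s * g t) = (\<lambda>x. of_real (s\<^sup>2) * acorr g x)"
  by (simp add: acorr_def corr_def fun_eq_iff power2_eq_square mult.assoc mult.left_commute)

lemma corr_scale: "corr h (\<lambda>x. c * f x) = (\<lambda>x. c * corr h f x)"
  by (simp add: corr_def fun_eq_iff mult.left_commute)

text \<open>A bump concentrated near \<open>0\<close> has a nonnegative autocorrelation that lives
  where \<open>Re h\<close> is positive, so the correlation at \<open>0\<close> has positive real
  part. This will make the supremum \<open>M\<close> positive.\<close>

lemma exists_positive_correlation:
  assumes h: "continuous_on UNIV h" and h0: "h 0 = 1"
  shows "\<exists>g. continuous_on UNIV g \<and> sqnorm (corr h (acorr g)) > 0"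
proof -
  have "open {x. Re (h x) > 0}"
    by (intro open_Collect_less continuous_intros h)
  \<comment> \<open>An autocorrelation is supported on differences of points of the support, so the
    set is pulled back along subtraction; the bump will vanish off
    \<open>V \<inter> W\<close>.\<close>
  then have "open ((\<lambda>p. fst p - snd p) -` {x. Re (h x) > 0})"
    by (intro open_vimage continuous_intros)
  moreover have "(0, 0) \<in> (\<lambda>p. fst p - snd p) -` {x. Re (h x) > 0}"
    using h0 by simp
  ultimately obtain V W where VW: "open V" "open W" "(0, 0) \<in> V \<times> W"
    "V \<times> W \<subseteq> (\<lambda>p. fst p - snd p) -` {x. Re (h x) > 0}"
    by (rule open_prod_elim)
  have "closed (- (V \<inter> W))" "closed {0 :: 'a}" "- (V \<inter> W) \<inter> {0} = {}"
    using VW by auto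
  then obtain g :: "'a \<Rightarrow> real" where g: "continuous_on UNIV g" "\<And>x. 0 \<le> g x"
    "\<And>x. x \<in> - (V \<inter> W) \<Longrightarrow> g x = 0" "\<And>x. x \<in> {0} \<Longrightarrow> g x = 1"
    using urysohn_function by metis
  define G where "G = (\<lambda>x. complex_of_real (g x))"
  have G: "continuous_on UNIV G" unfolding G_def by (intro continuous_intros g)
  define p where "p = (\<lambda>y. \<integral>x. g x * g (y + x) \<partial>m)"
  have p: "acorr G y = of_real (p y)" for y
    by (simp add: acorr_def corr_def p_def G_def flip: integral_complex_of_real)
  have p_nonneg: "p y \<ge> 0" for y
    unfolding p_def by (intro Bochner_Integration.integral_nonneg mult_nonneg_nonneg g)
  have p_cont: "continuous_on UNIV p"
  proof -
    have "p = (\<lambda>y. Re (acorr G y))" by (simp add: p)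
    then show ?thesis by (simp only:) (intro continuous_intros continuous_acorr G)
  qed
  have p_pos: "Re (h y) > 0" if "p y \<noteq> 0" for y
  proof -
    have "\<exists>x. g x * g (y + x) \<noteq> 0"
      using that unfolding p_def by (metis (no_types, lifting) Bochner_Integration.integral_zero Bochner_Integration.integral_cong)
    then obtain x where "y + x \<in> V" "x \<in> W"
      using g(3) by (metis ComplI IntE mult_zero_left mult_zero_right)
    then have "(y + x, x) \<in> V \<times> W" by simp
    from subsetD[OF VW(4) this] show ?thesis by simp
  qed
  have p0: "p 0 > 0"
    unfolding p_def
    by (rule integral_continuous_pos[of _ 0]) (auto intro!: continuous_intros g simp: g(4))
  have "(\<integral>t. Re (h t) * p t \<partial>m) > 0"
  proof (rule integral_continuous_pos)
    show "continuous_on UNIV (\<lambda>t. Re (h t) * p t)" by (intro continuous_intros h p_cont)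
    show "0 \<le> Re (h t) * p t" for t
      using p_pos[of t] p_nonneg[of t] by (cases "p t = 0") auto
    show "0 < Re (h 0) * p 0" using p0 h0 by simp
  qed
  also have "(\<integral>t. Re (h t) * p t \<partial>m) = (\<integral>t. Re (h t * acorr G (0 + t)) \<partial>m)"
    by (simp add: p)
  also have "\<dots> = Re (corr h (acorr G) 0)"
    unfolding corr_def[of h] by (rule integral_Re[OF integrable_corr[OF h continuous_acorr[OF G]]])
  finally have nz: "corr h (acorr G) 0 \<noteq> 0" by auto
  have "sqnorm (corr h (acorr G)) > 0"
    unfolding sqnorm_def
    by (rule integral_continuous_pos[of _ 0])
      (use nz in \<open>auto intro!: continuous_intros continuous_corr continuous_acorr h G\<close>)
  with G show ?thesis by blast
qed

text \<open>In terms of Fourier coefficients, \<^term>\<open>acorr g\<close> has the nonnegative coefficients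
  of total mass \<^term>\<open>sqnorm g\<close>, so the supremum \<open>M\<close> is approached only when that
  mass concentrates on a single character.\<close>

lemma maximal_correlation:
  assumes h: "continuous_on UNIV h" and h0: "h 0 = 1"
  obtains M where "M > 0"
    "\<And>g. continuous_on UNIV g \<Longrightarrow> sqnorm (corr h (acorr g)) \<le> M * (sqnorm g)\<^sup>2"
    "\<And>e. e > 0 \<Longrightarrow> \<exists>g. continuous_on UNIV g \<and> sqnorm g = 1 \<and> M - e \<le> sqnorm (corr h (acorr g))"
proof -
  define S where "S = (\<lambda>g. sqnorm (corr h (acorr g))) ` {g. continuous_on UNIV g \<and> sqnorm g = 1}"
  obtain B where B: "B > 0" "\<And>x. norm (h x) \<le> B" using bounded_continuous[OF h] by blast
  have "sqnorm (corr h (acorr g)) \<le> B\<^sup>2" if g: "continuous_on UNIV g" "sqnorm g = 1" for g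
  proof (rule sqnorm_le)
    show "norm (corr h (acorr g) x) \<le> B" for x
      unfolding corr_def
    proof (rule norm_integral_le)
      fix t
      have "norm (h t * acorr g (x + t)) \<le> B * 1"
        unfolding norm_mult using B norm_acorr_le[OF g(1)] g(2) by (intro mult_mono) auto
      then show "norm (h t * acorr g (x + t)) \<le> B" by simp
    qed
  qed
  then have bdd: "bdd_above S" unfolding S_def by (auto intro!: bdd_aboveI)
  have "sqnorm (\<lambda>x. 1) = 1" using prob_space by (simp add: sqnorm_def)
  then have ne: "S \<noteq> {}" unfolding S_def by (force intro!: continuous_intros)
  have bound: "sqnorm (corr h (acorr g)) \<le> Sup S * (sqnorm g)\<^sup>2" if g: "continuous_on UNIV g" for g
  proof (cases "sqnorm g = 0")
    case True
    then have "acorr g = (\<lambda>x. 0)" using norm_acorr_le[OF g] by (auto simp: fun_eq_iff)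
    then show ?thesis using True by (simp add: corr_def sqnorm_def)
  next
    case False
    \<comment> \<open>Both sides of the bound are homogeneous of degree four in \<open>g\<close>, so
      it is enough to normalize \<open>g\<close> to a unit vector.\<close>
    define s where "s = 1 / sqrt (sqnorm g)"
    have s2: "s\<^sup>2 * sqnorm g = 1" using False by (simp add: s_def power_divide)
    have "continuous_on UNIV (\<lambda>t. of_real s * g t)" by (intro continuous_intros g)
    moreover have "sqnorm (\<lambda>t. of_real s * g t) = 1" using s2 by (simp add: sqnorm_scale)
    ultimately have "sqnorm (corr h (acorr (\<lambda>t. of_real s * g t))) \<le> Sup S"
      by (intro cSup_upper bdd) (auto simp: S_def)
    then have "(s\<^sup>2)\<^sup>2 * sqnorm (corr h (acorr g)) \<le> Sup S"
      unfolding acorr_scale corr_scale sqnorm_scale by (simp add: norm_power)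
    then have "(s\<^sup>2)\<^sup>2 * sqnorm (corr h (acorr g)) * (sqnorm g)\<^sup>2 \<le> Sup S * (sqnorm g)\<^sup>2"
      by (intro mult_right_mono) auto
    also have "(s\<^sup>2)\<^sup>2 * sqnorm (corr h (acorr g)) * (sqnorm g)\<^sup>2
        = (s\<^sup>2 * sqnorm g)\<^sup>2 * sqnorm (corr h (acorr g))"
      by (simp add: power_mult_distrib)
    finally show ?thesis by (simp add: s2)
  qed
  obtain g where "continuous_on UNIV g" "sqnorm (corr h (acorr g)) > 0"
    using exists_positive_correlation[OF h h0] by blast
  then have "0 < Sup S * (sqnorm g)\<^sup>2" using bound[of g] by linarith
  then have pos: "Sup S > 0" by (simp add: zero_less_mult_iff)
  show thesis
  proof (rule that[OF pos bound])
    fix e :: real assume "e > 0"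
    then obtain s where "s \<in> S" "Sup S - e < s"
      using less_cSup_iff[OF ne bdd, of "Sup S - e"] by auto
    then show "\<exists>g. continuous_on UNIV g \<and> sqnorm g = 1 \<and> Sup S - e \<le> sqnorm (corr h (acorr g))"
      unfolding S_def by force
  qed
qed

end

text \<open>The restriction to \<open>e < c\<close> admits estimates known only for small
  \<open>e\<close>, such as those obtained for \<open>e < M / 2\<close> from
  near-maximizers.\<close>

lemma le_of_all_small_perturbations:
  fixes x b K c :: real
  assumes "c > 0" "\<And>e. 0 < e \<Longrightarrow> e < c \<Longrightarrow> x \<le> b + K * e"
  shows "x \<le> b"
proof (rule tendsto_lowerbound)
  show "((\<lambda>e. b + K * e) \<longlongrightarrow> b) (at_right 0)"
    by (rule tendsto_eq_intros refl | simp)+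
  show "\<forall>\<^sub>F e in at_right 0. x \<le> b + K * e"
    unfolding eventually_at_right_field using assms by blast
qed simp

context compact_haar
begin

text \<open>The functions \<open>acorr g\<close> of near-maximizers are multiplicative, continuous
  at \<open>0\<close> and different from 1 at \<open>a\<close>, each up to an error in
  \<open>e\<close>. Stated quantitatively, these conditions survive pointwise limits, and
  compactness of a product of discs yields a function fulfilling them without error.\<close>

theorem characters_separate:
  fixes a :: 'a
  assumes "a \<noteq> 0"
  shows "\<exists>\<xi>\<in>dual_group. \<xi> a \<noteq> 1"
proof -
  have "closed {a}" "closed {0 :: 'a}" "{a} \<inter> {0} = {}" using assms by auto
  then obtain k0 :: "'a \<Rightarrow> real" where k0: "continuous_on UNIV k0" "\<And>x. 0 \<le> k0 x" "\<And>x. k0 x \<le> 1"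
    "\<And>x. x \<in> {a} \<Longrightarrow> k0 x = 0" "\<And>x. x \<in> {0} \<Longrightarrow> k0 x = 1"
    using urysohn_function by metis
  define k where "k = (\<lambda>t. complex_of_real (k0 t))"
  have k: "continuous_on UNIV k" "norm (k t) \<le> 1" for t
    using k0 unfolding k_def by (auto intro!: continuous_intros)
  \<comment> \<open>As \<open>k 0 = 1\<close> and \<open>k a = 0\<close>, this gives
    \<open>h 0 = 1\<close>, and it is the form of kernel that \<open>not_near_one\<close> asks
    for.\<close>
  define h where "h = (\<lambda>t. k t - k (t + a))"
  have h: "continuous_on UNIV h"
    unfolding h_def by (intro continuous_intros k continuous_translate)
  have "h 0 = 1" by (simp add: h_def k_def k0(4,5))
  then obtain M where M: "M > 0"
      "\<And>g. continuous_on UNIV g \<Longrightarrow> sqnorm (corr h (acorr g)) \<le> M * (sqnorm g)\<^sup>2"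
      "\<And>e. e > 0 \<Longrightarrow> \<exists>g. continuous_on UNIV g \<and> sqnorm g = 1 \<and> M - e \<le> sqnorm (corr h (acorr g))"
    using maximal_correlation[OF h] by metis
  \<comment> \<open>The \<open>sqnorm\<close> of the correlation is replaced by its bounds
    \<open>M / 2\<close> and \<open>M\<close>, so that the conditions no longer mention
    \<open>g\<close>. The shape \<open>b + K * e\<close>, with \<open>0 +\<close> included, is that
    of \<open>le_of_all_small_perturbations\<close>.\<close>
  define C :: "real \<Rightarrow> ('a \<Rightarrow> complex) set" where "C e =
    {\<xi>. \<xi> 0 = 1 \<and> (\<forall>y z. (norm (\<xi> (y + z) - \<xi> y * \<xi> z))\<^sup>2 * (M / 2) \<le> 0 + 40 * e) \<and>
      (\<forall>y d. (\<forall>t. norm (h (t - y) - h t) \<le> d) \<longrightarrow> (norm (\<xi> y - 1))\<^sup>2 * (M / 2) \<le> 2 * d\<^sup>2 + 8 * e) \<and>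
      (M / 2)\<^sup>2 \<le> 2 * (norm (\<xi> a - 1))\<^sup>2 * M + 8 * e}" for e
  define K :: "('a \<Rightarrow> complex) set" where "K = Pi\<^sub>E UNIV (\<lambda>_. cball 0 1)"
  have "compact K"
    unfolding K_def compactin_euclidean_iff[symmetric] euclidean_product_topology[symmetric] compactin_PiE
    by (auto simp: compactin_euclidean_iff)
  have closed: "closed (C e)" for e
    unfolding C_def
    by (intro closed_Collect_conj closed_Collect_all closed_Collect_imp closed_Collect_eq closed_Collect_le
        continuous_intros continuous_on_product_coordinates) simp
  have mono: "C e \<subseteq> C e'" if "e \<le> e'" for e e'
  proof -
    have "0 + 40 * e \<le> 0 + 40 * e'" "8 * e \<le> 8 * e'" using that by auto
    then show ?thesis
      unfolding C_def by (auto intro: order_trans add_left_mono; smt (verit))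
  qed
  have nonempty: "K \<inter> C e \<noteq> {}" if e: "0 < e" "e \<le> M / 2" for e
  proof -
    obtain g where g: "continuous_on UNIV g" "sqnorm g = 1" "M - e \<le> sqnorm (corr h (acorr g))"
      using M(3)[OF \<open>e > 0\<close>] by blast
    let ?s = "sqnorm (corr h (acorr g))"
    have s: "M / 2 \<le> ?s" "?s \<le> M" using g e M(2)[OF g(1)] by auto
    note near = near_multiplicative[OF h g(1) M(2) g(2,3)] near_one[OF h g(1) M(2) g(2,3)]
      not_near_one[OF h g(1) M(2) g(2,3) k h_def]
    have "acorr g \<in> K"
      unfolding K_def using norm_acorr_le[OF g(1)] g(2) by (auto simp: PiE_def)
    moreover have "acorr g \<in> C e"
      unfolding C_def mem_Collect_eq
    proof (intro conjI allI impI)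
      show "acorr g 0 = 1" by (simp add: acorr_zero g(2))
      have mono_s: "x\<^sup>2 * (M / 2) \<le> x\<^sup>2 * ?s" "x\<^sup>2 * ?s \<le> x\<^sup>2 * M" for x :: real
        using s by (simp_all only: mult_left_mono zero_le_power2)
      show "(norm (acorr g (y + z) - acorr g y * acorr g z))\<^sup>2 * (M / 2) \<le> 0 + 40 * e" for y z
        using order_trans[OF mono_s(1) near(1)[of y z]] by simp
      show "(norm (acorr g y - 1))\<^sup>2 * (M / 2) \<le> 2 * d\<^sup>2 + 8 * e"
        if "\<forall>t. norm (h (t - y) - h t) \<le> d" for y d
        using order_trans[OF mono_s(1) near(2)[of y d]] that by simp
      have "(M / 2)\<^sup>2 \<le> ?s\<^sup>2" using s M(1) by (intro power_mono) auto
      also note near(3)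
      finally show "(M / 2)\<^sup>2 \<le> 2 * (norm (acorr g a - 1))\<^sup>2 * M + 8 * e"
        using mono_s(2)[of "norm (acorr g a - 1)"] by simp
    qed
    ultimately show ?thesis by blast
  qed
  have "K \<inter> (\<Inter>e\<in>{0<..M / 2}. C e) \<noteq> {}"
  proof (rule compact_imp_fip_image[OF \<open>compact K\<close> closed])
    fix I assume I: "finite I" "I \<subseteq> {0<..M / 2}"
    show "K \<inter> (\<Inter>e\<in>I. C e) \<noteq> {}"
    proof (cases "I = {}")
      case True
      then show ?thesis using nonempty[of "M / 2"] M(1) by auto
    next
      case False
      then have "Min I \<in> {0<..M / 2}" using I Min_in by blast
      then have "K \<inter> C (Min I) \<noteq> {}" using nonempty by simp
      moreover have "C (Min I) \<subseteq> (\<Inter>e\<in>I. C e)"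
        using I(1) mono by (meson INT_greatest Min_le)
      ultimately show ?thesis by blast
    qed
  qed
  then obtain \<xi> where \<xi>: "\<xi> \<in> K" "\<And>e. 0 < e \<Longrightarrow> e < M / 2 \<Longrightarrow> \<xi> \<in> C e"
    by fastforce
  have "M / 2 > 0" using M(1) by simp
  note limit = le_of_all_small_perturbations[OF this]
  have "\<xi> 0 = 1" using \<xi>(2)[of "M / 4"] M(1) by (simp add: C_def)
  have mult: "\<xi> (y + z) = \<xi> y * \<xi> z" for y z
  proof -
    have "(norm (\<xi> (y + z) - \<xi> y * \<xi> z))\<^sup>2 * (M / 2) \<le> 0"
      by (rule limit[of _ _ 40]) (use \<xi>(2) in \<open>auto simp: C_def\<close>)
    then show ?thesis using M(1) by (simp add: mult_le_0_iff)
  qed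
  have le1: "norm (\<xi> y) \<le> 1" for y
    using \<xi>(1) by (auto simp: K_def)
  have norm1: "norm (\<xi> y) = 1" for y
  proof -
    \<comment> \<open>Two factors of modulus at most 1 with product 1 both have modulus 1.\<close>
    have "norm (\<xi> y) * norm (\<xi> (- y)) = 1"
      using mult[of y "- y"] \<open>\<xi> 0 = 1\<close> by (simp flip: norm_mult)
    moreover have "norm (\<xi> y) * norm (\<xi> (- y)) \<le> norm (\<xi> y) * 1"
      by (intro mult_left_mono le1) auto
    ultimately show ?thesis using le1[of y] by linarith
  qed
  have near1: "(norm (\<xi> y - 1))\<^sup>2 * (M / 2) \<le> 2 * d\<^sup>2"
    if "\<And>t. norm (h (t - y) - h t) \<le> d" for y d
    by (rule limit[of _ _ 8]) (use \<xi>(2) that in \<open>auto simp: C_def\<close>)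
  have "continuous_on UNIV \<xi>"
  proof (rule continuous_on_groupI)
    fix e :: real assume "e > 0"
    \<comment> \<open>With this value \<open>near1\<close> yields
      \<open>norm (\<xi> u - 1) \<le> e / 2\<close>.\<close>
    define d where "d = e * sqrt M / 4"
    have "d > 0" using \<open>e > 0\<close> M(1) by (simp add: d_def)
    obtain U where U: "open U" "0 \<in> U" "\<And>x u. u \<in> U \<Longrightarrow> dist (h (x + u)) (h x) < d"
      using compact_group_uniformly_continuous[OF compact_UNIV h \<open>d > 0\<close>] by blast
    have "dist (\<xi> (x + u)) (\<xi> x) < e" if "u \<in> U" for u x
    proof -
      have "norm (h (t - u) - h t) \<le> d" for t
        using U(3)[OF that, of "t - u"] by (simp add: dist_norm norm_minus_commute)
      then have "(norm (\<xi> u - 1))\<^sup>2 * (M / 2) \<le> 2 * d\<^sup>2" by (rule near1)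
      also have "2 * d\<^sup>2 = e\<^sup>2 / 4 * (M / 2)"
        using M(1) by (simp add: d_def power_mult_distrib power_divide)
      finally have "(norm (\<xi> u - 1))\<^sup>2 \<le> e\<^sup>2 / 4"
        by (rule mult_right_le_imp_le) (use M(1) in simp)
      also have "\<dots> < e\<^sup>2" using \<open>e > 0\<close> by simp
      finally have "norm (\<xi> u - 1) < e" using \<open>e > 0\<close> by (simp add: power_less_imp_less_base)
      moreover have "dist (\<xi> (x + u)) (\<xi> x) = norm (\<xi> x * (\<xi> u - 1))"
        by (simp add: mult dist_norm algebra_simps)
      ultimately show ?thesis by (simp add: norm_mult norm1)
    qed
    then show "\<exists>U. open U \<and> 0 \<in> U \<and> (\<forall>u\<in>U. \<forall>x. dist (\<xi> (x + u)) (\<xi> x) < e)"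
      using U by blast
  qed
  then have "\<xi> \<in> dual_group" by (simp add: dual_group_def mult norm1)
  moreover have "(M / 2)\<^sup>2 \<le> 2 * (norm (\<xi> a - 1))\<^sup>2 * M"
    by (rule limit[of _ _ 8]) (use \<xi>(2) in \<open>auto simp: C_def\<close>)
  then have "\<xi> a \<noteq> 1" using M(1) by auto
  ultimately show ?thesis by blast
qed

end

section \<open>Trigonometric polynomials and uniqueness of Haar measure\<close>

lemma dual_groupD:
  assumes "\<gamma> \<in> dual_group"
  shows "continuous_on UNIV \<gamma>" "\<gamma> (x + y) = \<gamma> x * \<gamma> y" "norm (\<gamma> x) = 1" "\<gamma> 0 = 1" "\<gamma> (- x) = cnj (\<gamma> x)"
proof -
  show c: "continuous_on UNIV \<gamma>" and mult: "\<gamma> (x + y) = \<gamma> x * \<gamma> y" and n: "norm (\<gamma> x) = 1" for x y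
    using assms by (auto simp: dual_group_def)
  have "\<gamma> 0 * \<gamma> 0 = \<gamma> 0 * 1" using mult[of 0 0] by simp
  moreover have "\<gamma> 0 \<noteq> 0" using n[of 0] by auto
  ultimately show 0: "\<gamma> 0 = 1" by simp
  have "\<gamma> x \<noteq> 0" using n[of x] by auto
  moreover have "\<gamma> x * \<gamma> (- x) = \<gamma> x * cnj (\<gamma> x)"
    using mult[of x "- x"] n[of x] by (simp add: 0 complex_norm_square[symmetric])
  ultimately show "\<gamma> (- x) = cnj (\<gamma> x)" by simp
qed

lemma trivial_char_in_dual_group: "trivial_char \<in> dual_group"
  by (simp add: dual_group_def trivial_char_def)

text \<open>The linear span of the characters. Coefficients sit in the base case, so a merely
  additive functional that kills all \<open>c * \<gamma>\<close> vanishes on the span by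
  induction.\<close>

inductive_set trig_poly :: "('a :: topological_ab_group_add \<Rightarrow> complex) set" where
  char: "\<gamma> \<in> dual_group \<Longrightarrow> (\<lambda>x. c * \<gamma> x) \<in> trig_poly"
| add: "f \<in> trig_poly \<Longrightarrow> g \<in> trig_poly \<Longrightarrow> (\<lambda>x. f x + g x) \<in> trig_poly"

lemma trig_poly_continuous: "f \<in> trig_poly \<Longrightarrow> continuous_on UNIV f"
  by (induction rule: trig_poly.induct) (auto intro!: continuous_on_add continuous_on_mult dest: dual_groupD(1))

lemma trig_poly_const: "(\<lambda>x. c) \<in> trig_poly"
  using trig_poly.char[OF trivial_char_in_dual_group, of c] by (simp add: trivial_char_def)

lemma trig_poly_mult:
  assumes "f \<in> trig_poly" "g \<in> trig_poly"
  shows "(\<lambda>x. f x * g x) \<in> trig_poly"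
  using assms(1)
proof (induction rule: trig_poly.induct)
  case (char \<gamma> c)
  from assms(2) show ?case
  proof (induction rule: trig_poly.induct)
    case (char \<delta> d)
    have "(\<lambda>x. \<gamma> x * \<delta> x) \<in> dual_group"
      using \<open>\<gamma> \<in> dual_group\<close> char
      by (auto simp: dual_group_def norm_mult intro!: continuous_intros)
    from trig_poly.char[OF this, of "c * d"] show ?case by (simp add: ac_simps)
  next
    case (add f g)
    from trig_poly.add[OF add.IH] show ?case by (simp add: algebra_simps)
  qed
next
  case (add f1 f2)
  from trig_poly.add[OF add.IH] show ?case by (simp add: algebra_simps)
qed

lemma trig_poly_cnj: "f \<in> trig_poly \<Longrightarrow> (\<lambda>x. cnj (f x)) \<in> trig_poly"
proof (induction rule: trig_poly.induct)
  case (char \<gamma> c)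
  then have "(\<lambda>x. cnj (\<gamma> x)) \<in> dual_group"
    by (auto simp: dual_group_def intro!: continuous_intros)
  from trig_poly.char[OF this, of "cnj c"] show ?case by simp
qed (simp add: trig_poly.add)

context compact_haar
begin

lemma trig_poly_dense:
  fixes f :: "'a \<Rightarrow> real"
  assumes f: "continuous_on UNIV f" and "e > 0"
  shows "\<exists>p\<in>trig_poly. \<forall>x. norm (of_real (f x) - p x) < e"
proof -
  \<comment> \<open>The real form of Stone-Weierstrass is applied to the real-valued trigonometric
    polynomials; among them are the real and imaginary parts of characters, which separate
    points.\<close>
  define R where "R = {f :: 'a \<Rightarrow> real. (\<lambda>x. complex_of_real (f x)) \<in> trig_poly}"
  interpret function_ring_on R UNIV
  proof
    show "continuous_on UNIV f" if "f \<in> R" for f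
    proof -
      have "continuous_on UNIV (\<lambda>x. Re (complex_of_real (f x)))"
        using that unfolding R_def by (intro continuous_intros trig_poly_continuous) simp
      then show ?thesis by simp
    qed
    show "\<exists>f\<in>R. f x \<noteq> f y" if "x \<noteq> y" for x y
    proof -
      obtain \<xi> where \<xi>: "\<xi> \<in> dual_group" "\<xi> (x - y) \<noteq> 1"
        using characters_separate[of "x - y"] \<open>x \<noteq> y\<close> right_minus_eq by blast
      have "\<xi> x = \<xi> (x - y) * \<xi> y" using dual_groupD(2)[OF \<xi>(1), of "x - y" y] by simp
      moreover have "\<xi> y \<noteq> 0" using dual_groupD(3)[OF \<xi>(1), of y] by auto
      ultimately have ne: "\<xi> x \<noteq> \<xi> y" using \<xi>(2) by simp
      have p: "\<xi> \<in> trig_poly" using trig_poly.char[OF \<xi>(1), of 1] by simp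
      have "(\<lambda>z. 1 / 2 * (\<xi> z + cnj (\<xi> z))) \<in> trig_poly"
        by (intro trig_poly_mult trig_poly.add trig_poly_const trig_poly_cnj p)
      then have Re: "(\<lambda>z. Re (\<xi> z)) \<in> R" by (simp add: R_def complex_add_cnj)
      have "(\<lambda>z. - \<i> / 2 * (\<xi> z + (- 1) * cnj (\<xi> z))) \<in> trig_poly"
        by (intro trig_poly_mult trig_poly.add trig_poly_const trig_poly_cnj p)
      moreover have "- \<i> / 2 * (\<xi> z + (- 1) * cnj (\<xi> z)) = of_real (Im (\<xi> z))" for z
        by (simp add: complex_eq_iff)
      ultimately have Im: "(\<lambda>z. Im (\<xi> z)) \<in> R" by (simp add: R_def)
      from ne have "Re (\<xi> x) \<noteq> Re (\<xi> y) \<or> Im (\<xi> x) \<noteq> Im (\<xi> y)" by (simp add: complex_eq_iff)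
      then show ?thesis by (elim disjE) (rule bexI[OF _ Re], assumption, rule bexI[OF _ Im], assumption)
    qed
    show "(\<lambda>x. f x + g x) \<in> R" if "f \<in> R" "g \<in> R" for f g
      using trig_poly.add[OF that[unfolded R_def mem_Collect_eq]] by (simp add: R_def)
    show "(\<lambda>x. f x * g x) \<in> R" if "f \<in> R" "g \<in> R" for f g
      using trig_poly_mult[OF that[unfolded R_def mem_Collect_eq]] by (simp add: R_def)
  qed (simp_all add: R_def compact_UNIV trig_poly_const)
  obtain g where "g \<in> R" "\<And>x. \<bar>f x - g x\<bar> < e"
    using Stone_Weierstrass_basic[OF f \<open>e > 0\<close>] by auto
  moreover have "norm (complex_of_real (f x) - of_real (g x)) = \<bar>f x - g x\<bar>" for x
    by (simp flip: of_real_diff)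
  ultimately show ?thesis
    unfolding R_def by (intro bexI[of _ "\<lambda>x. complex_of_real (g x)"]) auto
qed

text \<open>\<open>L\<close> vanishes on trigonometric polynomials, and a uniform approximation
  error \<open>e\<close> contributes at most \<open>K * e\<close>. This serves both for the
  difference of two Haar integrals and for the Fourier criterion
  \<open>zero_one_of_fourier\<close>.\<close>

lemma functional_eq_zero:
  fixes L :: "('a \<Rightarrow> complex) \<Rightarrow> complex" and f :: "'a \<Rightarrow> real"
  assumes add: "\<And>f g. continuous_on UNIV f \<Longrightarrow> continuous_on UNIV g \<Longrightarrow> L (\<lambda>x. f x + g x) = L f + L g"
    and bound: "\<And>f e. continuous_on UNIV f \<Longrightarrow> (\<And>x. norm (f x) \<le> e) \<Longrightarrow> norm (L f) \<le> K * e"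
    and char: "\<And>\<gamma> c. \<gamma> \<in> dual_group \<Longrightarrow> L (\<lambda>x. c * \<gamma> x) = 0"
    and f: "continuous_on UNIV f"
  shows "L (\<lambda>x. of_real (f x)) = 0"
proof -
  have trig: "L p = 0" if "p \<in> trig_poly" for p
    using that by (induction rule: trig_poly.induct) (simp_all add: char add trig_poly_continuous)
  have "norm (L (\<lambda>x. of_real (f x))) \<le> 0 + K * e" if e: "0 < e" for e
  proof -
    obtain p where p: "p \<in> trig_poly" "\<And>x. norm (of_real (f x) - p x) < e"
      using trig_poly_dense[OF f e] by blast
    have cont: "continuous_on UNIV (\<lambda>x. of_real (f x) - p x)"
      by (intro continuous_intros f trig_poly_continuous p)
    have "L (\<lambda>x. of_real (f x)) = L (\<lambda>x. of_real (f x) - p x)"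
      using add[OF cont trig_poly_continuous[OF p(1)]] trig[OF p(1)] by simp
    also have "norm \<dots> \<le> K * e"
      by (intro bound cont less_imp_le p)
    finally show ?thesis by simp
  qed
  then have "norm (L (\<lambda>x. of_real (f x))) \<le> 0"
    by - (rule le_of_all_small_perturbations[of 1 _ _ K]; simp)
  then show ?thesis by simp
qed

section \<open>Regularity and approximation by continuous functions\<close>

lemma inner_approx:
  assumes B: "B \<in> sets borel" and e: "e > 0"
  obtains K where "compact K" "K \<subseteq> B" "measure m B - e < measure m K"
proof (cases "measure m B - e < 0")
  \<comment> \<open>A negative number would be truncated to 0 by \<open>ennreal\<close>; here the
    empty set already suffices.\<close>
  case True
  then show ?thesis by (intro that[of "{}"]) auto
next
  case False
  then have "ennreal (measure m B - e) < emeasure m B"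
    unfolding emeasure_eq_measure using e by (intro ennreal_lessI) linarith+
  also have "emeasure m B = (SUP K\<in>{K. K \<subseteq> B \<and> compact K}. emeasure m K)"
    using haar B by (simp add: haar_prob_def)
  finally obtain K where K: "K \<subseteq> B" "compact K" "ennreal (measure m B - e) < emeasure m K"
    by (auto simp: less_SUP_iff)
  then show ?thesis
    using False by (intro that[of K]) (auto simp: emeasure_eq_measure ennreal_less_iff)
qed

lemma outer_approx:
  assumes B: "B \<in> sets borel" and e: "e > 0"
  obtains U where "open U" "B \<subseteq> U" "measure m U < measure m B + e"
proof -
  have "- B \<in> sets borel" using B by auto
  then obtain K where K: "compact K" "K \<subseteq> - B" "measure m (- B) - e < measure m K"
    using e by (rule inner_approx)
  have "closed K" using K(1) by (rule compact_imp_closed)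
  then have "measure m (- K) = 1 - measure m K" "measure m (- B) = 1 - measure m B"
    using prob_compl[of K] prob_compl[of B] B by (simp_all add: Compl_eq_Diff_UNIV borel_closed)
  with K show ?thesis
    using \<open>closed K\<close> by (intro that[of "- K"]) auto
qed

lemma urysohn_between:
  fixes K U :: "'a set"
  assumes "compact K" "open U" "K \<subseteq> U"
  obtains f :: "'a \<Rightarrow> real" where "continuous_on UNIV f" "\<And>x. indicator K x \<le> f x" "\<And>x. f x \<le> indicator U x"
proof -
  have "closed (- U)" "closed K" "- U \<inter> K = {}"
    using assms by (auto intro: compact_imp_closed)
  then obtain f :: "'a \<Rightarrow> real" where f: "continuous_on UNIV f" "\<And>x. 0 \<le> f x" "\<And>x. f x \<le> 1"
    "\<And>x. x \<in> - U \<Longrightarrow> f x = 0" "\<And>x. x \<in> K \<Longrightarrow> f x = 1"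
    using urysohn_function by metis
  show ?thesis
    by (rule that[OF f(1)]) (use f in \<open>auto simp: indicator_def\<close>)
qed

lemma measure_le_integral:
  assumes "K \<in> sets borel" "continuous_on UNIV f" "\<And>x. indicator K x \<le> f x"
  shows "measure m K \<le> (\<integral>x. f x \<partial>m)"
proof -
  have "(\<integral>x. indicator K x \<partial>m) \<le> (\<integral>x. f x \<partial>m)"
    by (intro integral_mono assms integrable_continuous[OF assms(2)])
      (use assms(1) in \<open>simp add: emeasure_eq_measure\<close>)
  then show ?thesis by simp
qed

lemma integral_le_measure:
  assumes "U \<in> sets borel" "continuous_on UNIV f" "\<And>x. f x \<le> indicator U x"
  shows "(\<integral>x. f x \<partial>m) \<le> measure m U"
proof -
  have "(\<integral>x. f x \<partial>m) \<le> (\<integral>x. indicator U x \<partial>m)"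
    by (intro integral_mono assms integrable_continuous[OF assms(2)])
      (use assms(1) in \<open>simp add: emeasure_eq_measure\<close>)
  then show ?thesis by simp
qed

text \<open>Substituting \<open>x + z\<close> for \<open>x\<close> multiplies the integral by
  \<open>\<gamma> z\<close>, which differs from 1. A constant \<open>f\<close> gives the
  orthogonality of characters; the indicator of a preimage under an epimorphism is treated with
  \<open>z\<close> in the kernel.\<close>

lemma integral_invariant_char_eq_zero:
  assumes f: "f \<in> borel_measurable borel" and \<gamma>: "\<gamma> \<in> dual_group"
    and z: "\<And>x. f (x + z) = f x" "\<gamma> z \<noteq> 1"
  shows "(\<integral>x. f x * \<gamma> x \<partial>m) = 0"
proof -
  have "(\<lambda>x. f x * \<gamma> x) \<in> borel_measurable borel"
    by (intro borel_measurable_times f borel_measurable_continuous_onI dual_groupD \<gamma>)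
  from integral_translate[OF this, of z]
  moreover have "f (x + z) * \<gamma> (x + z) = \<gamma> z * (f x * \<gamma> x)" for x
    by (simp add: z dual_groupD[OF \<gamma>])
  ultimately have "(\<integral>x. f x * \<gamma> x \<partial>m) = \<gamma> z * (\<integral>x. f x * \<gamma> x \<partial>m)"
    by (simp only: integral_mult_right_zero)
  then have "(\<integral>x. f x * \<gamma> x \<partial>m) * (1 - \<gamma> z) = 0" by (simp add: algebra_simps)
  with z show ?thesis by simp
qed

lemma integral_char:
  assumes \<gamma>: "\<gamma> \<in> dual_group"
  shows "(\<integral>x. \<gamma> x \<partial>m) = (if \<gamma> = trivial_char then 1 else 0)"
proof (cases "\<gamma> = trivial_char")
  case True
  then show ?thesis using prob_space by (simp add: trivial_char_def)
next
  case False
  then obtain z where "\<gamma> z \<noteq> 1" by (auto simp: trivial_char_def)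
  then show ?thesis
    using integral_invariant_char_eq_zero[of "\<lambda>_. 1" \<gamma> z] \<gamma> False by simp
qed

end

text \<open>Characters have the same integrals under \<open>m\<close> and \<open>n\<close>, hence so
  do all continuous functions. One of these is placed between a compact set approximating
  \<open>B\<close> for \<open>m\<close> and an open set approximating \<open>B\<close> for
  \<open>n\<close>; each approximation costs one \<open>e\<close>.\<close>

lemma haar_unique_le:
  fixes m n :: "('a :: {topological_ab_group_add, t2_space}) measure"
  assumes m: "compact_haar m" and n: "compact_haar n" and B: "B \<in> sets borel"
  shows "measure m B \<le> measure n B"
proof -
  interpret m: compact_haar m by fact
  interpret n: compact_haar n by fact
  have eq: "(\<integral>x. f x \<partial>m) = (\<integral>x. f x \<partial>n)" if f: "continuous_on UNIV f" for f :: "'a \<Rightarrow> real"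
  proof -
    have "(\<integral>x. complex_of_real (f x) \<partial>m) - (\<integral>x. complex_of_real (f x) \<partial>n) = 0"
    proof (rule m.functional_eq_zero[where L = "\<lambda>f. integral\<^sup>L m f - integral\<^sup>L n f" and K = 2, OF _ _ _ f])
      fix f :: "'a \<Rightarrow> complex" and e :: real
      assume "\<And>x. norm (f x) \<le> e"
      then have "norm (integral\<^sup>L m f) + norm (integral\<^sup>L n f) \<le> e + e"
        by (intro add_mono m.norm_integral_le n.norm_integral_le)
      then show "norm (integral\<^sup>L m f - integral\<^sup>L n f) \<le> 2 * e"
        using norm_triangle_ineq4[of "integral\<^sup>L m f" "integral\<^sup>L n f"] by simp
    qed (simp_all add: m.integrable_continuous n.integrable_continuous m.integral_char n.integral_char)
    then show ?thesis by simp
  qed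
  have "measure m B \<le> measure n B + 2 * e" if e: "e > 0" for e
  proof -
    obtain K where K: "compact K" "K \<subseteq> B" "measure m B - e < measure m K"
      using m.inner_approx[OF B e] .
    obtain U where U: "open U" "B \<subseteq> U" "measure n U < measure n B + e"
      using n.outer_approx[OF B e] .
    obtain f :: "'a \<Rightarrow> real" where f: "continuous_on UNIV f" "\<And>x. indicator K x \<le> f x" "\<And>x. f x \<le> indicator U x"
      using m.urysohn_between[of K U] K U by blast
    have "measure m K \<le> (\<integral>x. f x \<partial>m)"
      using K(1) f by (intro m.measure_le_integral) (auto intro: borel_compact)
    also have "\<dots> = (\<integral>x. f x \<partial>n)" by (rule eq[OF f(1)])
    also have "\<dots> \<le> measure n U"
      using U(1) f by (intro n.integral_le_measure) auto
    finally show ?thesis using K U by linarith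
  qed
  then show ?thesis
    by - (rule le_of_all_small_perturbations[of 1 _ _ 2]; simp)
qed

lemma haar_unique:
  assumes m: "compact_haar m" and n: "compact_haar n"
  shows "m = n"
proof (rule measure_eqI)
  interpret m: compact_haar m by fact
  interpret n: compact_haar n by fact
  show "sets m = sets n" by simp
  fix B assume "B \<in> sets m"
  then have "measure m B = measure n B"
    by (intro antisym haar_unique_le m n) auto
  then show "emeasure m B = emeasure n B"
    by (simp add: m.emeasure_eq_measure n.emeasure_eq_measure)
qed

section \<open>Epimorphisms preserve Haar measure\<close>

lemma EpiD:
  assumes "\<tau> \<in> Epi"
  shows "continuous_on UNIV \<tau>" "\<tau> (x + y) = \<tau> x + \<tau> y" "surj \<tau>" "\<tau> 0 = 0" "\<tau> (- x) = - \<tau> x"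
proof -
  show "continuous_on UNIV \<tau>" and add: "\<tau> (x + y) = \<tau> x + \<tau> y" and "surj \<tau>" for x y
    using assms by (auto simp: Epi_def)
  show 0: "\<tau> 0 = 0" using add[of 0 0] by simp
  show "\<tau> (- x) = - \<tau> x" using add[of "- x" x] by (simp add: 0 eq_neg_iff_add_eq_0)
qed

context compact_haar
begin

lemma measurable_Epi [measurable (raw)]: "\<tau> \<in> Epi \<Longrightarrow> \<tau> \<in> measurable m m"
  using borel_measurable_continuous_onI[OF EpiD(1), of \<tau>] by (simp cong: measurable_cong_sets)

text \<open>By surjectivity, translation by \<open>a\<close> lifts to translation by a preimage
  \<open>b\<close>. Inner regularity passes to the image measure because compact subsets of the
  preimage of \<open>B\<close> have compact images inside \<open>B\<close>. With uniqueness this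
  yields \<open>distr_Epi\<close>.\<close>

lemma compact_haar_distr_Epi:
  assumes \<tau>: "\<tau> \<in> Epi"
  shows "compact_haar (distr m m \<tau>)"
proof
  have meas: "\<tau> \<in> measurable m m" by (rule measurable_Epi[OF \<tau>])
  have meas_add: "(\<lambda>x. a + x) \<in> measurable m m" for a
    by (simp cong: measurable_cong_sets)
      (intro borel_measurable_continuous_onI continuous_intros)
  show "compact (UNIV :: 'a set)" by (rule compact_UNIV)
  show "haar_prob (distr m m \<tau>)"
    unfolding haar_prob_def
  proof (intro conjI allI ballI)
    show "prob_space (distr m m \<tau>)" by (rule prob_space_distr[OF meas])
    show "sets (distr m m \<tau>) = sets borel" by simp
    fix a
    obtain b where b: "a = \<tau> b" using EpiD(3)[OF \<tau>] by (metis surjD)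
    have "distr (distr m m \<tau>) (distr m m \<tau>) (\<lambda>x. a + x) = distr (distr m m \<tau>) m (\<lambda>x. a + x)"
      by (rule distr_cong) simp_all
    also have "\<dots> = distr m m ((\<lambda>x. a + x) \<circ> \<tau>)" by (rule distr_distr[OF meas_add meas])
    also have "(\<lambda>x. a + x) \<circ> \<tau> = \<tau> \<circ> (\<lambda>x. b + x)" by (simp add: fun_eq_iff b EpiD[OF \<tau>])
    also have "distr m m (\<tau> \<circ> (\<lambda>x. b + x)) = distr (distr m m (\<lambda>x. b + x)) m \<tau>"
      by (rule distr_distr[OF meas meas_add, symmetric])
    also have "distr m m (\<lambda>x. b + x) = m" using haar by (simp add: haar_prob_def)
    finally show "distr (distr m m \<tau>) (distr m m \<tau>) (\<lambda>x. a + x) = distr m m \<tau>" .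
  next
    fix B assume "B \<in> sets (distr m m \<tau>)"
    then have B: "B \<in> sets borel" "B \<in> sets m" by simp_all
    have pre: "\<tau> -` B \<in> sets m" using measurable_sets[OF meas B(2)] by simp
    show "emeasure (distr m m \<tau>) B = (SUP K\<in>{K. K \<subseteq> B \<and> compact K}. emeasure (distr m m \<tau>) K)"
    proof (rule antisym)
      have "emeasure (distr m m \<tau>) B = emeasure m (\<tau> -` B)"
        using emeasure_distr[OF meas B(2)] by simp
      also have "\<dots> = (SUP K\<in>{K. K \<subseteq> \<tau> -` B \<and> compact K}. emeasure m K)"
        using haar pre by (simp add: haar_prob_def)
      also have "\<dots> \<le> (SUP K\<in>{K. K \<subseteq> B \<and> compact K}. emeasure (distr m m \<tau>) K)"
      proof (rule SUP_mono)
        fix K assume K: "K \<in> {K. K \<subseteq> \<tau> -` B \<and> compact K}"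
        have cpt: "compact (\<tau> ` K)"
          using K EpiD(1)[OF \<tau>] by (auto intro!: compact_continuous_image intro: continuous_on_subset)
        then have img: "\<tau> ` K \<in> sets m" by (simp add: borel_compact)
        have "emeasure m K \<le> emeasure m (\<tau> -` \<tau> ` K)"
          using measurable_sets[OF meas img] by (intro emeasure_mono) auto
        also have "\<dots> = emeasure (distr m m \<tau>) (\<tau> ` K)"
          using emeasure_distr[OF meas img] by simp
        finally show "\<exists>K'\<in>{K. K \<subseteq> B \<and> compact K}. emeasure m K \<le> emeasure (distr m m \<tau>) K'"
          using cpt K by (intro bexI[of _ "\<tau> ` K"]) auto
      qed
      finally show "emeasure (distr m m \<tau>) B \<le> (SUP K\<in>{K. K \<subseteq> B \<and> compact K}. emeasure (distr m m \<tau>) K)" .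
      show "(SUP K\<in>{K. K \<subseteq> B \<and> compact K}. emeasure (distr m m \<tau>) K) \<le> emeasure (distr m m \<tau>) B"
        using B by (intro SUP_least emeasure_mono) auto
    qed
  qed
qed

lemma distr_Epi:
  assumes "\<tau> \<in> Epi"
  shows "distr m m \<tau> = m"
  by (intro haar_unique compact_haar_distr_Epi assms compact_haar_axioms)

lemma measure_vimage_Epi:
  assumes \<tau>: "\<tau> \<in> Epi" and B: "B \<in> sets borel"
  shows "emeasure m (\<tau> -` B) = emeasure m B"
  using emeasure_distr[OF measurable_Epi[OF \<tau>], of B] B by (simp add: distr_Epi[OF \<tau>])

text \<open>The indicator of \<open>B\<close> has the Fourier coefficients of the constant
  \<open>c = measure m B\<close>, so its integral against any continuous \<open>f\<close> is
  \<open>c\<close> times the integral of \<open>f\<close>. Taking \<open>f\<close> close to the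
  indicator itself yields \<open>c \<le> c * c\<close>.\<close>

lemma zero_one_of_fourier:
  assumes B: "B \<in> sets borel"
    and fourier: "\<And>\<gamma>. \<gamma> \<in> dual_group \<Longrightarrow> \<gamma> \<noteq> trivial_char \<Longrightarrow> (\<integral>x. indicator B x * \<gamma> x \<partial>m) = 0"
  shows "measure m B = 0 \<or> measure m B = 1"
proof -
  define c where "c = measure m B"
  have [measurable]: "B \<in> sets m" using B by simp
  have intB: "integrable m (\<lambda>x. indicator B x * f x)" if f: "continuous_on UNIV f" for f :: "'a \<Rightarrow> complex"
  proof -
    obtain b where "\<And>x. norm (f x) \<le> b" "b > 0" using bounded_continuous[OF f] by blast
    then show ?thesis
      using measurable_continuous[OF f]
      by (intro integrable_const_bound[of _ b]) (auto simp: indicator_def)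
  qed
  have eq: "(\<integral>x. indicator B x * f x \<partial>m) = c * (\<integral>x. f x \<partial>m)" if f: "continuous_on UNIV f" for f :: "'a \<Rightarrow> real"
  proof -
    have "(\<integral>x. indicator B x * complex_of_real (f x) \<partial>m) - c * (\<integral>x. complex_of_real (f x) \<partial>m) = 0"
    proof (rule functional_eq_zero[where L = "\<lambda>f. (\<integral>x. indicator B x * f x \<partial>m) - c * integral\<^sup>L m f" and K = 2, OF _ _ _ f])
      fix f :: "'a \<Rightarrow> complex" and e :: real
      assume e: "\<And>x. norm (f x) \<le> e"
      then have "e \<ge> 0" using norm_ge_zero order_trans by blast
      have "norm (\<integral>x. indicator B x * f x \<partial>m) \<le> e"
        using e \<open>e \<ge> 0\<close> by (intro norm_integral_le) (auto simp: indicator_def)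
      moreover have "norm (c * integral\<^sup>L m f) \<le> 1 * e"
        unfolding norm_mult by (intro mult_mono norm_integral_le e) (auto simp: c_def)
      ultimately show "norm ((\<integral>x. indicator B x * f x \<partial>m) - c * integral\<^sup>L m f) \<le> 2 * e"
        using norm_triangle_ineq4[of "\<integral>x. indicator B x * f x \<partial>m" "c * integral\<^sup>L m f"] by simp
    next
      fix \<gamma> :: "'a \<Rightarrow> complex" and d :: complex
      assume \<gamma>: "\<gamma> \<in> dual_group"
      have "(\<integral>x. indicator B x * (d * \<gamma> x) \<partial>m) = d * (\<integral>x. indicator B x * \<gamma> x \<partial>m)"
        by (simp add: mult.left_commute)
      moreover have "(\<integral>x. indicator B x * trivial_char x \<partial>m) = (\<integral>x. complex_of_real (indicator B x) \<partial>m)"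
        by (intro Bochner_Integration.integral_cong) (auto simp: trivial_char_def indicator_def)
      then have "(\<integral>x. indicator B x * trivial_char x \<partial>m) = c"
        by (simp add: c_def)
      ultimately show "(\<integral>x. indicator B x * (d * \<gamma> x) \<partial>m) - c * (\<integral>x. d * \<gamma> x \<partial>m) = 0"
        using fourier[OF \<gamma>] integral_char[OF \<gamma>] by (cases "\<gamma> = trivial_char") simp_all
    qed (simp add: distrib_left intB integrable_continuous)
    moreover have "(\<integral>x. indicator B x * complex_of_real (f x) \<partial>m) = complex_of_real (\<integral>x. indicator B x * f x \<partial>m)"
      by (subst integral_complex_of_real[symmetric]) (auto simp: indicator_def intro!: Bochner_Integration.integral_cong)
    ultimately have "complex_of_real (\<integral>x. indicator B x * f x \<partial>m) = complex_of_real (c * (\<integral>x. f x \<partial>m))"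
      by simp
    then show ?thesis by (simp only: of_real_eq_iff)
  qed
  \<comment> \<open>One \<open>e\<close> is lost at the compact set inside \<open>B\<close>, the
    other as \<open>c * e \<le> e\<close> at the open set around \<open>B\<close>.\<close>
  have "c \<le> c * c + 2 * e" if e: "e > 0" for e
  proof -
    obtain K where K: "compact K" "K \<subseteq> B" "measure m B - e < measure m K"
      using inner_approx[OF B e] .
    obtain U where U: "open U" "B \<subseteq> U" "measure m U < measure m B + e"
      using outer_approx[OF B e] .
    obtain f :: "'a \<Rightarrow> real" where f: "continuous_on UNIV f" "\<And>x. indicator K x \<le> f x" "\<And>x. f x \<le> indicator U x"
      using urysohn_between[of K U] K U by blast
    have sets: "K \<in> sets m" "U \<in> sets m" using K U by (auto intro: borel_compact)
    have "measure m K = (\<integral>x. indicator K x \<partial>m)" by simp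
    also have "\<dots> \<le> (\<integral>x. indicator B x * f x \<partial>m)"
    proof (intro integral_mono)
      show "indicator K x \<le> indicator B x * f x" for x
        using f(2)[of x] K(2) by (auto simp: indicator_def split: if_splits)
      show "integrable m (indicator K :: 'a \<Rightarrow> real)" using sets by (simp add: emeasure_eq_measure)
      show "integrable m (\<lambda>x. indicator B x * f x)"
        using integrable_real_mult_indicator[OF \<open>B \<in> sets m\<close> integrable_continuous[OF f(1)]]
        by (simp add: mult.commute)
    qed
    also have "\<dots> = c * (\<integral>x. f x \<partial>m)" by (rule eq[OF f(1)])
    also have "\<dots> \<le> c * measure m U"
      using U(1) f by (intro mult_left_mono integral_le_measure) (auto simp: c_def)
    also have "\<dots> \<le> c * (c + e)"
      using U(3) by (intro mult_left_mono) (auto simp: c_def)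
    also have "\<dots> \<le> c * c + e"
      using prob_le_1[of B] e by (simp add: c_def distrib_left mult_left_le_one_le)
    finally show ?thesis using K(3) by (simp add: c_def)
  qed
  then have "c \<le> c * c"
    by - (rule le_of_all_small_perturbations[of 1 _ _ 2]; simp)
  moreover have "0 \<le> c" "c \<le> 1" by (auto simp: c_def)
  ultimately have "c = 0 \<or> c = 1"
    by (metis antisym mult_le_cancel_left1 mult_left_le order_le_less)
  then show ?thesis by (simp add: c_def)
qed

end

section \<open>Ergodicity of the skew product\<close>

text \<open>\<open>\<gamma>\<close> is constant on the fibres of \<open>\<tau>\<close>, so the
  choice of preimage made by \<open>inv\<close> is immaterial. The induced \<open>\<xi>\<close> is
  continuous because its preimage of a closed set is the \<open>\<tau>\<close>-image of a compact
  set.\<close>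

lemma factor_through_epi:
  fixes \<tau> :: "'a :: {topological_ab_group_add, t2_space} \<Rightarrow> 'a"
  assumes compact: "compact (UNIV :: 'a set)" and \<tau>: "\<tau> \<in> Epi" and \<gamma>: "\<gamma> \<in> dual_group"
    and ker: "\<And>z. \<tau> z = 0 \<Longrightarrow> \<gamma> z = 1"
  shows "\<gamma> \<in> adjoint_char \<tau> ` dual_group"
proof -
  define \<xi> where "\<xi> = \<gamma> \<circ> inv \<tau>"
  have eq: "\<gamma> x = \<gamma> y" if "\<tau> x = \<tau> y" for x y
  proof -
    have "\<tau> (x + (- y)) = 0" using that by (simp only: EpiD[OF \<tau>]) simp
    then have "\<gamma> (x + (- y)) = 1" by (rule ker)
    then have "\<gamma> (x + (- y)) * \<gamma> y = \<gamma> y" by simp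
    then show ?thesis using dual_groupD(2)[OF \<gamma>, of "x + (- y)" y] by simp
  qed
  have \<tau>_inv: "\<tau> (inv \<tau> y) = y" for y using EpiD(3)[OF \<tau>] by (rule surj_f_inv_f)
  have \<xi>_\<tau>: "\<xi> (\<tau> x) = \<gamma> x" for x
    unfolding \<xi>_def comp_def by (rule eq) (rule \<tau>_inv)
  have "\<xi> \<in> dual_group"
    unfolding dual_group_def
  proof (intro CollectI conjI allI)
    show "continuous_on UNIV \<xi>"
    proof (subst continuous_on_closed_vimage[OF closed_UNIV], intro allI impI)
      fix C :: "complex set" assume "closed C"
      have "\<xi> -` C = \<tau> ` (\<gamma> -` C)"
      proof
        show "\<xi> -` C \<subseteq> \<tau> ` (\<gamma> -` C)"
        proof
          fix y assume "y \<in> \<xi> -` C"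
          then have "inv \<tau> y \<in> \<gamma> -` C" by (simp add: \<xi>_def)
          then show "y \<in> \<tau> ` (\<gamma> -` C)" by (rule rev_image_eqI) (rule \<tau>_inv[symmetric])
        qed
      qed (auto simp: \<xi>_\<tau>)
      moreover have "closed (\<gamma> -` C)"
        using \<open>closed C\<close> dual_groupD(1)[OF \<gamma>] by (rule closed_vimage)
      then have "compact (\<gamma> -` C)"
        using compact compact_Int_closed[of UNIV "\<gamma> -` C"] by simp
      then have "compact (\<tau> ` (\<gamma> -` C))"
        using EpiD(1)[OF \<tau>] by (intro compact_continuous_image) (auto intro: continuous_on_subset)
      ultimately show "closed (\<xi> -` C \<inter> UNIV)" by (simp add: compact_imp_closed)
    qed
    show "\<xi> (x + y) = \<xi> x * \<xi> y" for x y
      using \<xi>_\<tau>[of "inv \<tau> x + inv \<tau> y"]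
      by (simp add: EpiD[OF \<tau>] \<tau>_inv dual_groupD[OF \<gamma>]) (simp add: \<xi>_def)
    show "norm (\<xi> x) = 1" for x by (simp add: \<xi>_def dual_groupD[OF \<gamma>])
  qed
  moreover have "\<gamma> = adjoint_char \<tau> \<xi>"
    by (simp add: adjoint_char_def fun_eq_iff \<xi>_\<tau>)
  ultimately show ?thesis by blast
qed

lemma (in compact_haar) fourier_vimage_eq_zero:
  assumes \<tau>: "\<tau> \<in> Epi" and \<gamma>: "\<gamma> \<in> dual_group" "\<gamma> \<notin> adjoint_char \<tau> ` dual_group"
    and B: "B \<in> sets borel"
  shows "(\<integral>x. indicator (\<tau> -` B) x * \<gamma> x \<partial>m) = 0"
proof -
  obtain z where z: "\<tau> z = 0" "\<gamma> z \<noteq> 1"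
    using factor_through_epi[OF compact_UNIV \<tau> \<gamma>(1)] \<gamma>(2) by blast
  have "\<tau> -` B \<in> sets borel"
    using measurable_sets[OF measurable_Epi[OF \<tau>], of B] B by simp
  then have "indicator (\<tau> -` B) \<in> borel_measurable borel" by (rule borel_measurable_indicator)
  then show ?thesis
    by (rule integral_invariant_char_eq_zero[OF _ \<gamma>(1), where z = z])
      (simp_all add: indicator_def EpiD[OF \<tau>] z)
qed

section \<open>Iterates of the skew product\<close>

lemma id_in_Epi: "id \<in> Epi"
  by (simp add: Epi_def)

lemma comp_in_Epi:
  assumes \<tau>: "\<tau> \<in> Epi" and \<rho>: "\<rho> \<in> Epi"
  shows "\<tau> \<circ> \<rho> \<in> Epi"
  unfolding Epi_def
proof (intro CollectI conjI allI)
  show "continuous_on UNIV (\<tau> \<circ> \<rho>)"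
    unfolding comp_def by (intro continuous_on_comp_UNIV[OF EpiD(1)[OF \<tau>]] EpiD(1)[OF \<rho>])
  show "surj (\<tau> \<circ> \<rho>)" by (intro comp_surj EpiD(3) \<tau> \<rho>)
qed (simp add: EpiD(2)[OF \<tau>] EpiD(2)[OF \<rho>])

lemma cocycle_in_Epi: "\<omega> \<in> Epi_seqs \<Longrightarrow> cocycle n \<omega> \<in> Epi"
  by (induction n) (auto simp: Epi_seqs_def simp del: id_apply intro: id_in_Epi comp_in_Epi)

lemma seq_shift_in_Epi_seqs: "\<omega> \<in> Epi_seqs \<Longrightarrow> seq_shift \<omega> \<in> Epi_seqs"
  by (simp add: Epi_seqs_def seq_shift_def)

lemma funpow_seq_shift: "(seq_shift ^^ n) \<omega> = (\<lambda>k. \<omega> (n + k))"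
  by (induction n) (auto simp: seq_shift_def)

text \<open>Invariance is an equality of sets, so it iterates without exceptional null sets and
  presents the section over each \<open>\<omega>\<close> as a preimage under the
  \<open>n\<close>-step cocycle.\<close>

lemma invariant_set_iterate:
  assumes inv: "skew_product -` A \<inter> Epi_seqs \<times> UNIV = A" and \<omega>: "\<omega> \<in> Epi_seqs"
  shows "(\<omega>, x) \<in> A \<longleftrightarrow> ((seq_shift ^^ n) \<omega>, cocycle n \<omega> x) \<in> A"
proof (induction n)
  case (Suc n)
  have "(seq_shift ^^ n) \<omega> \<in> Epi_seqs"
    using \<omega> by (simp add: funpow_seq_shift Epi_seqs_def)
  then have "((seq_shift ^^ n) \<omega>, cocycle n \<omega> x) \<in> A
      \<longleftrightarrow> skew_product ((seq_shift ^^ n) \<omega>, cocycle n \<omega> x) \<in> A"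
    using inv by blast
  also have "skew_product ((seq_shift ^^ n) \<omega>, cocycle n \<omega> x) = ((seq_shift ^^ Suc n) \<omega>, cocycle (Suc n) \<omega> x)"
    by (simp add: skew_product_def funpow_seq_shift[of n])
  finally show ?case using Suc.IH by simp
qed simp

section \<open>The measure-preserving skew product and its ergodicity\<close>

locale epi_skew_product = compact_haar m
  for m :: "('a :: {topological_ab_group_add, t2_space}) measure" +
  fixes \<mu> :: "(nat \<Rightarrow> 'a \<Rightarrow> 'a) measure"
  assumes space_\<mu>: "space \<mu> = Epi_seqs"
    and evaluation_measurable: "(\<lambda>(\<omega>, x). \<omega> 0 x) \<in> measurable (\<mu> \<Otimes>\<^sub>M borel) borel"
    and shift_invariant: "invariant_prob \<mu> seq_shift"
begin

sublocale base: prob_space \<mu>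
  using shift_invariant by (simp add: invariant_prob_def)

sublocale skew: pair_prob_space \<mu> m ..

lemma measurable_seq_shift [measurable]: "seq_shift \<in> measurable \<mu> \<mu>"
  using shift_invariant by (simp add: invariant_prob_def)

lemma measurable_skew_product: "skew_product \<in> measurable (\<mu> \<Otimes>\<^sub>M m) (\<mu> \<Otimes>\<^sub>M m)"
proof -
  have "sets (\<mu> \<Otimes>\<^sub>M m) = sets (\<mu> \<Otimes>\<^sub>M borel)"
    by (rule sets_pair_measure_cong) simp_all
  then have [measurable]: "(\<lambda>(\<omega>, x). \<omega> 0 x) \<in> measurable (\<mu> \<Otimes>\<^sub>M m) m"
    using evaluation_measurable by (simp cong: measurable_cong_sets)
  have eq: "skew_product = (\<lambda>p. (seq_shift (fst p), (\<lambda>(\<omega>, x). \<omega> 0 x) p))"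
    by (auto simp: skew_product_def)
  show ?thesis unfolding eq by measurable
qed

text \<open>Rectangles suffice. Over \<open>\<omega>\<close> the preimage of
  \<open>A \<times> B\<close> has an empty section unless \<open>seq_shift \<omega> \<in> A\<close>,
  and then its section is the preimage of \<open>B\<close> under \<open>\<omega> 0\<close>, with the
  measure of \<open>B\<close>. Integration and shift invariance give the product.\<close>

lemma invariant_prob_skew_product: "invariant_prob (\<mu> \<Otimes>\<^sub>M m) skew_product"
  unfolding invariant_prob_def
proof (intro conjI measurable_skew_product)
  show "prob_space (\<mu> \<Otimes>\<^sub>M m)" by (rule skew.P.prob_space_axioms)
  show "distr (\<mu> \<Otimes>\<^sub>M m) (\<mu> \<Otimes>\<^sub>M m) skew_product = \<mu> \<Otimes>\<^sub>M m"
  proof (rule pair_measure_eqI[symmetric])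
    fix A B assume AB: "A \<in> sets \<mu>" "B \<in> sets m"
    let ?P = "skew_product -` (A \<times> B) \<inter> space (\<mu> \<Otimes>\<^sub>M m)"
    have P: "?P \<in> sets (\<mu> \<Otimes>\<^sub>M m)"
      using AB by (intro measurable_sets[OF measurable_skew_product]) auto
    have sect: "emeasure m (Pair \<omega> -` ?P) = emeasure m B * indicator (seq_shift -` A \<inter> space \<mu>) \<omega>"
      if \<omega>: "\<omega> \<in> space \<mu>" for \<omega>
    proof -
      have "Pair \<omega> -` ?P = (if seq_shift \<omega> \<in> A then \<omega> 0 -` B else {})"
        using \<omega> by (auto simp: skew_product_def space_pair_measure)
      moreover have "\<omega> 0 \<in> Epi" using \<omega> by (simp add: space_\<mu> Epi_seqs_def)
      ultimately show ?thesis
        using \<omega> AB(2) measure_vimage_Epi[of "\<omega> 0" B] by (simp add: indicator_def)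
    qed
    have "emeasure (distr (\<mu> \<Otimes>\<^sub>M m) (\<mu> \<Otimes>\<^sub>M m) skew_product) (A \<times> B) = emeasure (\<mu> \<Otimes>\<^sub>M m) ?P"
      using AB by (intro emeasure_distr measurable_skew_product) auto
    also have "\<dots> = (\<integral>\<^sup>+\<omega>. emeasure m (Pair \<omega> -` ?P) \<partial>\<mu>)"
      by (rule emeasure_pair_measure_alt[OF P])
    also have "\<dots> = (\<integral>\<^sup>+\<omega>. emeasure m B * indicator (seq_shift -` A \<inter> space \<mu>) \<omega> \<partial>\<mu>)"
      by (intro nn_integral_cong sect)
    also have "\<dots> = emeasure m B * emeasure \<mu> (seq_shift -` A \<inter> space \<mu>)"
      using AB(1) by (intro nn_integral_cmult_indicator measurable_sets[OF measurable_seq_shift])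
    also have "emeasure \<mu> (seq_shift -` A \<inter> space \<mu>) = emeasure (distr \<mu> \<mu> seq_shift) A"
      using AB(1) by (intro emeasure_distr[symmetric] measurable_seq_shift)
    also have "distr \<mu> \<mu> seq_shift = \<mu>" using shift_invariant by (simp add: invariant_prob_def)
    finally show "emeasure \<mu> A * emeasure m B = emeasure (distr (\<mu> \<Otimes>\<^sub>M m) (\<mu> \<Otimes>\<^sub>M m) skew_product) (A \<times> B)"
      by (simp add: mult.commute)
  qed (simp_all add: base.sigma_finite_measure_axioms sigma_finite_measure_axioms)
qed

text \<open>An invariant set of the base lifts to the invariant cylinder
  \<open>A \<times> UNIV\<close> of the same measure.\<close>

lemma ergodic_base:
  assumes erg: "ergodic (\<mu> \<Otimes>\<^sub>M m) skew_product"
  shows "ergodic \<mu> seq_shift"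
  unfolding ergodic_def
proof (intro conjI shift_invariant ballI impI)
  fix A assume A: "A \<in> sets \<mu>" "seq_shift -` A \<inter> space \<mu> = A"
  have "A \<times> UNIV \<in> sets (\<mu> \<Otimes>\<^sub>M m)" using A(1) sets.top[of m] by (intro pair_measureI) simp_all
  moreover have "skew_product -` (A \<times> UNIV) \<inter> space (\<mu> \<Otimes>\<^sub>M m) = A \<times> UNIV"
    using A(2) by (auto simp: skew_product_def space_pair_measure)
  ultimately have "measure (\<mu> \<Otimes>\<^sub>M m) (A \<times> UNIV) = 0 \<or> measure (\<mu> \<Otimes>\<^sub>M m) (A \<times> UNIV) = 1"
    using erg unfolding ergodic_def by blast
  moreover have "emeasure (\<mu> \<Otimes>\<^sub>M m) (A \<times> UNIV) = emeasure \<mu> A"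
    using emeasure_pair_measure_Times[OF A(1) sets.top] emeasure_space_1 by simp
  ultimately show "measure \<mu> A = 0 \<or> measure \<mu> A = 1" by (simp add: measure_def)
qed

lemma section_zero_one:
  assumes A: "A \<in> sets (\<mu> \<Otimes>\<^sub>M m)" "skew_product -` A \<inter> space (\<mu> \<Otimes>\<^sub>M m) = A"
    and tight: "fourier_tight \<mu>"
  shows "AE \<omega> in \<mu>. measure m (Pair \<omega> -` A) = 0 \<or> measure m (Pair \<omega> -` A) = 1"
  using tight[unfolded fourier_tight_def]
proof (rule AE_mp, intro AE_I2 impI)
  fix \<omega> assume \<omega>: "\<omega> \<in> space \<mu>" and tight: "\<forall>\<Gamma>. finite \<Gamma> \<and> \<Gamma> \<subseteq> dual_group \<longrightarrow>
      (\<exists>m\<^sub>0. \<forall>m\<ge>m\<^sub>0. adjoint_char (cocycle m \<omega>) ` (dual_group - {trivial_char}) \<subseteq> dual_group - \<Gamma>)"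
  have inv: "skew_product -` A \<inter> Epi_seqs \<times> UNIV = A"
    using A(2) by (simp add: space_pair_measure space_\<mu>)
  have \<omega>E: "\<omega> \<in> Epi_seqs" using \<omega> by (simp add: space_\<mu>)
  have sect: "Pair \<omega> -` A \<in> sets borel" for \<omega>
    using sets_Pair1[OF A(1), of \<omega>] by simp
  show "measure m (Pair \<omega> -` A) = 0 \<or> measure m (Pair \<omega> -` A) = 1"
  proof (rule zero_one_of_fourier[OF sect])
    fix \<gamma> :: "'a \<Rightarrow> complex" assume \<gamma>: "\<gamma> \<in> dual_group" "\<gamma> \<noteq> trivial_char"
    \<comment> \<open>That \<open>n\<close> depends on \<open>\<gamma>\<close> does no harm: for
      every \<open>n\<close> the same section is a preimage under the cocycle.\<close>
    then obtain n where n: "adjoint_char (cocycle n \<omega>) ` (dual_group - {trivial_char}) \<subseteq> dual_group - {\<gamma>}"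
      using tight[rule_format, of "{\<gamma>}"] by auto
    \<comment> \<open>Tightness speaks of nontrivial characters only; the remaining one is sent to
      itself and so misses \<open>\<gamma>\<close>.\<close>
    moreover have "adjoint_char (cocycle n \<omega>) trivial_char = trivial_char"
      by (simp add: adjoint_char_def trivial_char_def comp_def)
    ultimately have "\<gamma> \<notin> adjoint_char (cocycle n \<omega>) ` dual_group"
      using \<gamma>(2) by blast
    moreover have "Pair \<omega> -` A = cocycle n \<omega> -` (Pair ((seq_shift ^^ n) \<omega>) -` A)"
      using invariant_set_iterate[OF inv \<omega>E, of _ n] by auto
    ultimately show "(\<integral>x. indicator (Pair \<omega> -` A) x * \<gamma> x \<partial>m) = 0"
      using fourier_vimage_eq_zero[OF cocycle_in_Epi[OF \<omega>E] \<gamma>(1) _ sect] by metis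
  qed
qed

lemma ergodic_skew_product:
  assumes erg: "ergodic \<mu> seq_shift" and tight: "fourier_tight \<mu>"
  shows "ergodic (\<mu> \<Otimes>\<^sub>M m) skew_product"
  unfolding ergodic_def
proof (intro conjI invariant_prob_skew_product ballI impI)
  fix A assume A: "A \<in> sets (\<mu> \<Otimes>\<^sub>M m)" "skew_product -` A \<inter> space (\<mu> \<Otimes>\<^sub>M m) = A"
  define f where "f = (\<lambda>\<omega>. emeasure m (Pair \<omega> -` A))"
  have f [measurable]: "f \<in> borel_measurable \<mu>"
    unfolding f_def by (rule measurable_emeasure_Pair[OF A(1)])
  define B where "B = {\<omega> \<in> space \<mu>. f \<omega> = 1}"
  have B: "B \<in> sets \<mu>" unfolding B_def by measurable
  have shift: "f (seq_shift \<omega>) = f \<omega>" if \<omega>: "\<omega> \<in> space \<mu>" for \<omega>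
  proof -
    have "Pair \<omega> -` A = \<omega> 0 -` (Pair (seq_shift \<omega>) -` A)"
      using invariant_set_iterate[of A \<omega> _ 1] A(2) \<omega>
      by (auto simp: space_pair_measure space_\<mu>)
    moreover have "\<omega> 0 \<in> Epi" using \<omega> by (simp add: space_\<mu> Epi_seqs_def)
    moreover have "Pair (seq_shift \<omega>) -` A \<in> sets borel"
      using sets_Pair1[OF A(1), of "seq_shift \<omega>"] by simp
    ultimately show ?thesis unfolding f_def by (simp add: measure_vimage_Epi)
  qed
  \<comment> \<open>Since \<open>shift\<close> holds at every point of the space, the invariance is
    strict, as the definition of \<open>ergodic\<close> demands.\<close>
  have "seq_shift -` B \<inter> space \<mu> = B"
    using shift seq_shift_in_Epi_seqs by (auto simp: B_def space_\<mu>)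
  with erg B have zero_one: "measure \<mu> B = 0 \<or> measure \<mu> B = 1"
    unfolding ergodic_def by blast
  have "emeasure (\<mu> \<Otimes>\<^sub>M m) A = (\<integral>\<^sup>+\<omega>. f \<omega> \<partial>\<mu>)"
    unfolding f_def by (rule emeasure_pair_measure_alt[OF A(1)])
  \<comment> \<open>Almost every section is null or conull, so \<open>A\<close> has the same measure
    as the invariant base set \<open>B\<close>.\<close>
  also have "\<dots> = (\<integral>\<^sup>+\<omega>. indicator B \<omega> \<partial>\<mu>)"
  proof (rule nn_integral_cong_AE)
    show "AE \<omega> in \<mu>. f \<omega> = indicator B \<omega>"
      using section_zero_one[OF A tight] AE_space
    proof eventually_elim
      case (elim \<omega>)
      then show ?case
        by (auto simp: B_def f_def emeasure_eq_measure)
    qed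
  qed
  also have "\<dots> = emeasure \<mu> B" using B by simp
  finally show "measure (\<mu> \<Otimes>\<^sub>M m) A = 0 \<or> measure (\<mu> \<Otimes>\<^sub>M m) A = 1"
    using zero_one by (simp add: measure_def)
qed

end

theorem theorem4p1:
  fixes m :: "('a :: {topological_ab_group_add, t2_space}) measure"
    and \<mu> :: "(nat \<Rightarrow> 'a \<Rightarrow> 'a) measure"
  assumes compact_G: "compact (UNIV :: 'a set)"
    and countable_dual: "countable (dual_group :: ('a \<Rightarrow> complex) set)"
    and haar: "haar_prob m"
    and space_\<mu>: "space \<mu> = Epi_seqs"
    and evaluation_measurable:
      "(\<lambda>(\<omega>, x). \<omega> 0 x) \<in> measurable (\<mu> \<Otimes>\<^sub>M borel) borel"
    and shift_invariant: "invariant_prob \<mu> seq_shift"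
    and tight: "fourier_tight \<mu>"
  shows "ergodic (\<mu> \<Otimes>\<^sub>M m) skew_product \<longleftrightarrow> ergodic \<mu> seq_shift"
proof -
  interpret epi_skew_product m \<mu>
    by unfold_locales (fact compact_G haar space_\<mu> evaluation_measurable shift_invariant)+
  show ?thesis
    using ergodic_base ergodic_skew_product tight by blast
qed

end
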